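(* Let $G=\frac1n\sum_{i=1}^nG_i$ with $G_i:\mathbb{R}^p\to\mathbb{R}^p$, and suppose that: $\{x:Gx=0\}\ne\emptyset$; there is $L>0$ with $\frac1n\sum_{i=1}^n\|G_ix-G_iy\|^2\le L^2\|x-y\|^2$ for all $x,y\in\mathbb{R}^p$; and there exist $x^\star$ with $Gx^\star=0$ and $\kappa\ge0$ such that $\langle Gx,x-x^\star\rangle\ge-\kappa\|Gx\|^2$ for all $x\in\mathbb{R}^p$. Let $b\in\{1,\dots,n\}$ and $\mathbf{p}\in(0,1)$ satisfy $b\mathbf{p}^2\le1$, let $\gamma:=\frac34$, and set $$\rho:=\frac{\mathbf{p}}2,\quad C:=\frac{4-6\mathbf{p}+3\mathbf{p}^2}{b\mathbf{p}},\quad\hat C:=\frac{2\gamma^2(2-3\mathbf{p}+\mathbf{p}^2)}{b\mathbf{p}},\quad M:=\frac{57}{24}+\frac{11(C+\hat C)}{3\rho}.$$ Assume $L\kappa\le\frac1{16\sqrt M}$. Let $\{x^k\}$ be generated by $x^{k+1}:=x^k-\eta\widetilde S^k_\gamma$, $k\ge0$, using the loopless-SVRG estimator $\widetilde S^k_\gamma$ (see context) with parameters $b,\mathbf{p}$, and $\eta:=\frac1{L\sqrt M}$. Then $\eta\ge\frac{0.1440\sqrt b\,\mathbf{p}}L$ and, for every $K\ge0$, $$\frac1{K+1}\sum_{k=0}^K\mathbb{E}\big[\|Gx^k\|^2\big]\le\frac{526\,L^2\|x^0-x^\star\|^2}{b\mathbf{p}^2(K+1)}.$$ Moreover, for $\epsilon>0$,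 if $\mathbf{p}:=n^{-1/3}$ and $b:=\lfloor n^{2/3}\rfloor$ (with $n\ge2$), then the method requires $$\mathcal{T}_{G_i}:=n+\Big\lfloor\frac{4\Gamma L^2R_0^2n^{2/3}}{\epsilon^2}\Big\rfloor,\qquad\Gamma:=731,\quad R_0:=\|x^0-x^\star\|,$$ evaluations of the $G_i$ to attain $\frac1{K+1}\sum_{k=0}^K\mathbb{E}[\|Gx^k\|^2]\le\epsilon^2$; that is, there is $K$ for which this inequality holds and such that producing $x^0,\dots,x^K$ uses at most $\mathcal{T}_{G_i}$ evaluations of the components $G_i$ (in expectation over the snapshot coin flips).
   Context: Norms and inner products are Euclidean; $x^0$ is deterministic and $x^{-1}:=x^0$. Loopless-SVRG estimator. Put $w^0:=x^0$. At each iteration $k\ge0$, a mini-batch $\mathcal{B}_k\subseteq\{1,\dots,n\}$ of fixed size $b$ is drawn uniformly at random, independently of everything generated before; with $G_{\mathcal{B}_k}z:=\frac1b\sum_{i\in\mathcal{B}_k}G_iz$ one sets $$\widetilde S^k_\gamma:=(1-\gamma)\big(Gw^k-G_{\mathcal{B}_k}w^k\big)+G_{\mathcal{B}_k}x^k-\gamma G_{\mathcal{B}_k}x^{k-1}$$ (so $\widetilde S^0_\gamma=(1-\gamma)Gx^0$). After computing $x^{k+1}$, by an independent coin flip, $w^{k+1}:=x^k$ with probability $\mathbf{p}$ and $w^{k+1}:=w^k$ with probability $1-\mathbf{p}$. Counting of evaluations: $n$ for the initial $Gw^0$; $3b$ per iteration (for $G_{\mathcal{B}_k}w^k,G_{\mathcal{B}_k}x^k,G_{\mathcal{B}_k}x^{k-1}$);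 and $n$ more whenever the snapshot is refreshed (probability $\mathbf{p}$ per iteration), i.e. $n\mathbf{p}+3b$ per iteration in expectation. Producing $x^0,\dots,x^K$ takes $K$ iterations. *)

theory Defs
  imports "HOL-Probability.Probability"
begin

definition avg_op :: "nat \<Rightarrow> (nat \<Rightarrow> 'a \<Rightarrow> 'a) \<Rightarrow> 'a \<Rightarrow> 'a::real_vector" where
  "avg_op n G z = (1 / real n) *\<^sub>R (\<Sum>i\<in>{1..n}. G i z)"

definition batch_op :: "nat \<Rightarrow> (nat \<Rightarrow> 'a \<Rightarrow> 'a) \<Rightarrow> nat set \<Rightarrow> 'a \<Rightarrow> 'a::real_vector" where
  "batch_op b G S z = (1 / real b) *\<^sub>R (\<Sum>i\<in>S. G i z)"

text \<open>The arguments \<open>w\<close>, \<open>y\<close>, \<open>z\<close> stand for the snapshot, the current iterate and the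
  previous iterate.\<close>

definition svrg_estimator ::
  "nat \<Rightarrow> nat \<Rightarrow> (nat \<Rightarrow> 'a \<Rightarrow> 'a) \<Rightarrow> real \<Rightarrow> nat set \<Rightarrow> 'a \<Rightarrow> 'a \<Rightarrow> 'a \<Rightarrow> 'a::real_vector" where
  "svrg_estimator n b G \<gamma> S w y z =
     (1 - \<gamma>) *\<^sub>R (avg_op n G w - batch_op b G S w) + batch_op b G S y - \<gamma> *\<^sub>R batch_op b G S z"

definition mini_batches :: "nat \<Rightarrow> nat \<Rightarrow> nat set set" where
  "mini_batches n b = {S. S \<subseteq> {1..n} \<and> card S = b}"

text \<open>All randomness is in the mini-batches \<open>B k\<close> and the coins \<open>coin k\<close>. Drawing each of them
  independently of everything generated before means that the pairs \<open>(B k, coin k)\<close> are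
  independent over \<open>k\<close> and that each pair has the product law of a uniform \<open>b\<close>-subset of
  \<open>{1..n}\<close> and a Bernoulli variable. The truncated subtraction in \<open>x (k - 1)\<close> implements the
  convention that the iterate with index \<open>-1\<close> is the one with index \<open>0\<close>.\<close>

locale loopless_svrg = prob_space P
  for P :: "'w measure" +
  fixes n b :: nat
    and p \<gamma> \<eta> :: real
    and G :: "nat \<Rightarrow> 'a \<Rightarrow> 'a::real_vector"
    and x0 :: 'a
    and B :: "nat \<Rightarrow> 'w \<Rightarrow> nat set"
    and coin :: "nat \<Rightarrow> 'w \<Rightarrow> bool"
    and x w :: "nat \<Rightarrow> 'w \<Rightarrow> 'a"
  assumes batch_in: "\<omega> \<in> space P \<Longrightarrow> B k \<omega> \<in> mini_batches n b"
    and draws_indep: "indep_vars (\<lambda>_. count_space UNIV) (\<lambda>k \<omega>. (B k \<omega>, coin k \<omega>)) UNIV"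
    and draws_law: "distr P (count_space UNIV) (\<lambda>\<omega>. (B k \<omega>, coin k \<omega>)) =
           measure_pmf (pair_pmf (pmf_of_set (mini_batches n b)) (bernoulli_pmf p))"
    and x_0: "\<omega> \<in> space P \<Longrightarrow> x 0 \<omega> = x0"
    and w_0: "\<omega> \<in> space P \<Longrightarrow> w 0 \<omega> = x0"
    and x_Suc: "\<omega> \<in> space P \<Longrightarrow> x (Suc k) \<omega> =
           x k \<omega> - \<eta> *\<^sub>R svrg_estimator n b G \<gamma> (B k \<omega>) (w k \<omega>) (x k \<omega>) (x (k - 1) \<omega>)"
    and w_Suc: "\<omega> \<in> space P \<Longrightarrow> w (Suc k) \<omega> = (if coin k \<omega> then x k \<omega> else w k \<omega>)"

text \<open>Evaluations of the components \<open>G i\<close> in the first \<open>K\<close> iterations, for given coin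
  outcomes \<open>c\<close>: \<open>n\<close> initially, \<open>3 * b\<close> per iteration, and \<open>n\<close> per snapshot refresh.\<close>

definition component_evals :: "nat \<Rightarrow> nat \<Rightarrow> (nat \<Rightarrow> bool) \<Rightarrow> nat \<Rightarrow> nat" where
  "component_evals n b c K = n + (\<Sum>k<K. 3 * b + (if c k then n else 0))"

end

theory Submission
  imports Defs
begin

text \<open>
  Write \<open>g\<close> for the mean map and \<open>S\<^sub>k = g (x k) - \<gamma> g (x (k - 1))\<close> for the reflected direction that the
  estimator approximates. Averaged over the mini-batch, the estimator equals \<open>S\<^sub>k\<close>, since the
  snapshot terms cancel. Its mean squared error is at most \<open>D\<^sub>k\<close>, the average over \<open>i\<close>, divided by
  \<open>b\<close>, of \<open>\<parallel>G\<^sub>i (x k) - \<gamma> G\<^sub>i (x (k - 1)) - (1 - \<gamma>) G\<^sub>i (w k)\<parallel>\<^sup>2\<close>: the terms of the mini-batch are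
  negatively correlated, so sampling without replacement is no worse than independent sampling
  (\<open>batch_noise_second_moment\<close>).

  Three quantities are tracked in expectation: the noise \<open>D\<^sub>k\<close>, the squared step
  \<open>U\<^sub>k = L\<^sup>2 \<parallel>x k - x (k - 1)\<parallel>\<^sup>2\<close>, and the squared distance \<open>W\<^sub>k\<close> to the solution of the shifted point
  \<open>x k + \<gamma> \<eta> g (x (k - 1))\<close>. The shift turns the reflected iteration into a plain gradient-like step:
  the shifted point moves by \<open>- (1 - \<gamma>) \<eta> g (x k)\<close> plus noise, and the weak Minty inequality
  together with the polarization identity for \<open>g (x (k - 1)) \<bullet> g (x k)\<close> gives a decrease of \<open>W\<^sub>k\<close> by a
  multiple of \<open>\<parallel>g (x k)\<parallel>\<^sup>2\<close> and \<open>\<parallel>g (x (k - 1))\<parallel>\<^sup>2\<close>, up to \<open>U\<^sub>k\<close> and \<open>D\<^sub>k\<close> (\<open>lyapunov_Suc\<close>). A refresh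
  with probability \<open>p\<close> makes \<open>D\<^sub>k\<close> contract by \<open>1 - p / 2\<close> up to multiples \<open>C\<close> and \<open>C'\<close> of the two
  latest squared steps (\<open>mean_noise_Suc\<close>), and \<open>U\<^sub>k\<^sub>+\<^sub>1\<close> is at most \<open>(\<parallel>S\<^sub>k\<parallel>\<^sup>2 + D\<^sub>k) / M\<close> because
  \<open>\<eta>\<^sup>2 L\<^sup>2 = 1 / M\<close> (\<open>mean_sq_step_Suc\<close>).

  These inequalities are summed over \<open>k\<close> and not combined into one Lyapunov function
  (\<open>telescoped_descent\<close>). The choice of \<open>M\<close> makes the total noise at most \<open>3 M / 11\<close> times the total
  squared step, so the last inequality can be solved for the total step. The noise is then at most
  \<open>3 / 8\<close> of \<open>\<Sum>k. \<parallel>S\<^sub>k\<parallel>\<^sup>2\<close>, whose leading part is exactly compensated by the decrease in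
  \<open>\<parallel>g (x k)\<parallel>\<^sup>2\<close>; the decrease in \<open>\<parallel>g (x (k - 1))\<parallel>\<^sup>2\<close>, which is a shifted copy of the same sum, remains.

  All randomness comes from finitely many values per iteration, so the triple of current iterate,
  previous iterate and snapshot is a Markov chain with finitely many states at each time. Conditional
  expectations reduce to finite averages: \<open>mean_Suc\<close> moves from time \<open>k + 1\<close> to time \<open>k\<close> by averaging
  over one draw, and every probabilistic step is a pointwise inequality about that average.
\<close>

section \<open>Sampling without replacement\<close>

lemma card_supersets_of_size:
  assumes "finite U" "A \<subseteq> U" "card A \<le> b"
  shows "card {S. S \<subseteq> U \<and> card S = b \<and> A \<subseteq> S} = (card U - card A) choose (b - card A)"
proof -
  have "finite A"
    using assms finite_subset by blast
  have "bij_betw (\<lambda>T. T \<union> A) {T. T \<subseteq> U - A \<and> card T = b - card A}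
          {S. S \<subseteq> U \<and> card S = b \<and> A \<subseteq> S}"
  proof (rule bij_betw_byWitness[where f' = "\<lambda>S. S - A"])
    show "(\<lambda>T. T \<union> A) ` {T. T \<subseteq> U - A \<and> card T = b - card A}
            \<subseteq> {S. S \<subseteq> U \<and> card S = b \<and> A \<subseteq> S}"
    proof safe
      fix T assume T: "T \<subseteq> U - A" "card T = b - card A"
      then have "finite T"
        using assms(1) finite_subset by blast
      then have "card (T \<union> A) = card T + card A"
        using T \<open>finite A\<close> by (intro card_Un_disjoint) auto
      then show "card (T \<union> A) = b"
        using T assms by simp
    qed (use assms in auto)
    show "(\<lambda>S. S - A) ` {S. S \<subseteq> U \<and> card S = b \<and> A \<subseteq> S}
            \<subseteq> {T. T \<subseteq> U - A \<and> card T = b - card A}"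
      using \<open>finite A\<close> by (auto simp: card_Diff_subset)
  qed auto
  then have "card {S. S \<subseteq> U \<and> card S = b \<and> A \<subseteq> S} = card {T. T \<subseteq> U - A \<and> card T = b - card A}"
    by (rule bij_betw_same_card[symmetric])
  also have "\<dots> = card (U - A) choose (b - card A)"
    using assms by (intro n_subsets) auto
  also have "card (U - A) = card U - card A"
    using assms \<open>finite A\<close> by (simp add: card_Diff_subset)
  finally show ?thesis .
qed

lemma finite_mini_batches: "finite (mini_batches n b)"
  unfolding mini_batches_def by (rule finite_subset[of _ "Pow {1..n}"]) auto

lemma card_mini_batches: "card (mini_batches n b) = n choose b"
  unfolding mini_batches_def by (subst n_subsets) auto

lemma mini_batchesD:
  assumes "S \<in> mini_batches n b"
  shows "S \<subseteq> {1..n}" "card S = b" "finite S"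
  using assms finite_subset unfolding mini_batches_def by auto

lemma batch_count_identity:
  assumes "b \<in> {1..n}"
  shows "real b * real (n choose b) = real n * real ((n - 1) choose (b - 1))"
proof -
  have "b * (n choose b) = n * ((n - 1) choose (b - 1))"
    using assms by (intro times_binomial_minus1_eq) auto
  then show ?thesis
    by (metis of_nat_mult)
qed

lemma card_batches_containing:
  assumes "b \<in> {1..n}" "i \<in> {1..n}"
  shows "card {S \<in> mini_batches n b. i \<in> S} = (n - 1) choose (b - 1)"
proof -
  have "{S \<in> mini_batches n b. i \<in> S} = {S. S \<subseteq> {1..n} \<and> card S = b \<and> {i} \<subseteq> S}"
    unfolding mini_batches_def by blast
  then show ?thesis
    using card_supersets_of_size[of "{1..n}" "{i}" b] assms by simp
qed

lemma sum_over_batches: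
  fixes f :: "nat \<Rightarrow> 'a::real_vector"
  assumes "b \<in> {1..n}"
  shows "(\<Sum>S\<in>mini_batches n b. \<Sum>i\<in>S. f i)
           = (real b * real (n choose b) / real n) *\<^sub>R (\<Sum>i\<in>{1..n}. f i)"
proof -
  let ?c = "real ((n - 1) choose (b - 1))"
  have c: "real b * real (n choose b) / real n = ?c"
    using batch_count_identity[OF assms] assms by simp
  have "(\<Sum>S\<in>mini_batches n b. \<Sum>i\<in>S. f i)
      = (\<Sum>S\<in>mini_batches n b. \<Sum>i\<in>{i\<in>{1..n}. i \<in> S}. f i)"
    by (intro sum.cong) (auto simp: mini_batches_def)
  also have "\<dots> = (\<Sum>i\<in>{1..n}. \<Sum>S\<in>{S\<in>mini_batches n b. i \<in> S}. f i)"
    by (rule sum.swap_restrict) (auto simp: finite_mini_batches)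
  also have "\<dots> = (\<Sum>i\<in>{1..n}. ?c *\<^sub>R f i)"
    by (intro sum.cong) (auto simp: card_batches_containing[OF assms] sum_constant_scaleR simp del: sum_constant)
  finally show ?thesis
    by (simp add: c scaleR_sum_right)
qed

text \<open>
  Two distinct indices lie together in the same number \<open>c\<close> of batches, whichever they are, so only the
  diagonal needs a separate weight. For the inner products of
  centered vectors the last sum vanishes, and \<open>c \<ge> 0\<close> lowers the weight of the diagonal.
\<close>

lemma sum_pairs_over_batches:
  fixes f :: "nat \<Rightarrow> nat \<Rightarrow> real"
  assumes "b \<in> {1..n}"
  obtains c where "0 \<le> c"
    "(\<Sum>S\<in>mini_batches n b. \<Sum>i\<in>S. \<Sum>j\<in>S. f i j)
       = (real b * real (n choose b) / real n - c) * (\<Sum>i\<in>{1..n}. f i i)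
         + c * (\<Sum>i\<in>{1..n}. \<Sum>j\<in>{1..n}. f i j)"
proof -
  define c1 where "c1 = real b * real (n choose b) / real n"
  define c where "c = (if b = 1 then 0 else real ((n - 2) choose (b - 2)))"
  have two: "real (card {S \<in> mini_batches n b. i \<in> S \<and> j \<in> S}) = c"
    if "i \<in> {1..n}" "j \<in> {1..n}" "i \<noteq> j" for i j
  proof (cases "b = 1")
    case True
    have "i = j" if "S \<in> mini_batches n b" "i \<in> S" "j \<in> S" for S
      using mini_batchesD(2)[OF that(1)] that True by (metis card_1_singletonE singletonD)
    then have "{S \<in> mini_batches n b. i \<in> S \<and> j \<in> S} = {}"
      using \<open>i \<noteq> j\<close> by blast
    then show ?thesis
      by (simp only: c_def True) simp
  next
    case False
    have "{S \<in> mini_batches n b. i \<in> S \<and> j \<in> S} = {S. S \<subseteq> {1..n} \<and> card S = b \<and> {i, j} \<subseteq> S}"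
      unfolding mini_batches_def by blast
    moreover have c2: "card {i, j} = 2"
      using \<open>i \<noteq> j\<close> by simp
    ultimately have "card {S \<in> mini_batches n b. i \<in> S \<and> j \<in> S} = (n - 2) choose (b - 2)"
      using card_supersets_of_size[of "{1..n}" "{i, j}" b] that assms False unfolding c2
      by (simp only:) simp
    then show ?thesis
      using False by (simp add: c_def)
  qed
  have one: "real (card {S \<in> mini_batches n b. i \<in> S}) = c1" if "i \<in> {1..n}" for i
    using card_batches_containing[OF assms that] batch_count_identity[OF assms] assms
    by (simp add: c1_def)
  have inner: "(\<Sum>S\<in>{S\<in>mini_batches n b. i \<in> S}. \<Sum>j\<in>S. f i j)
      = (c1 - c) * f i i + c * (\<Sum>j\<in>{1..n}. f i j)" if i: "i \<in> {1..n}" for i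
  proof -
    have "(\<Sum>S\<in>{S\<in>mini_batches n b. i \<in> S}. \<Sum>j\<in>S. f i j)
        = (\<Sum>S\<in>{S\<in>mini_batches n b. i \<in> S}. \<Sum>j\<in>{j\<in>{1..n}. j \<in> S}. f i j)"
      by (intro sum.cong) (auto simp: mini_batches_def)
    also have "\<dots> = (\<Sum>j\<in>{1..n}. \<Sum>S\<in>{S\<in>{S\<in>mini_batches n b. i \<in> S}. j \<in> S}. f i j)"
      by (rule sum.swap_restrict) (auto simp: finite_mini_batches)
    also have "\<dots> = (\<Sum>j\<in>{1..n}. real (card {S\<in>mini_batches n b. i \<in> S \<and> j \<in> S}) * f i j)"
      by (intro sum.cong) (auto simp: conj_ac)
    also have "\<dots> = (\<Sum>j\<in>{1..n}. c * f i j + (if j = i then (c1 - c) * f i j else 0))"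
      using i by (intro sum.cong refl) (auto simp: two one algebra_simps)
    also have "\<dots> = (c1 - c) * f i i + c * (\<Sum>j\<in>{1..n}. f i j)"
      using i by (simp add: sum.distrib sum_distrib_left)
    finally show ?thesis .
  qed
  have "(\<Sum>S\<in>mini_batches n b. \<Sum>i\<in>S. \<Sum>j\<in>S. f i j)
      = (\<Sum>S\<in>mini_batches n b. \<Sum>i\<in>{i\<in>{1..n}. i \<in> S}. \<Sum>j\<in>S. f i j)"
    by (intro sum.cong) (auto simp: mini_batches_def)
  also have "\<dots> = (\<Sum>i\<in>{1..n}. \<Sum>S\<in>{S\<in>mini_batches n b. i \<in> S}. \<Sum>j\<in>S. f i j)"
    by (rule sum.swap_restrict) (auto simp: finite_mini_batches)
  also have "\<dots> = (\<Sum>i\<in>{1..n}. (c1 - c) * f i i + c * (\<Sum>j\<in>{1..n}. f i j))"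
    by (intro sum.cong refl inner)
  finally have "(\<Sum>S\<in>mini_batches n b. \<Sum>i\<in>S. \<Sum>j\<in>S. f i j)
       = (c1 - c) * (\<Sum>i\<in>{1..n}. f i i) + c * (\<Sum>i\<in>{1..n}. \<Sum>j\<in>{1..n}. f i j)"
    by (simp add: sum.distrib sum_distrib_left)
  moreover have "0 \<le> c"
    by (simp add: c_def)
  ultimately show thesis
    using that unfolding c1_def by blast
qed

lemma norm2_add_scaleR:
  fixes v t :: "'a::real_inner"
  shows "(norm (v + a *\<^sub>R t))\<^sup>2 = (norm v)\<^sup>2 + 2 * a * (v \<bullet> t) + a\<^sup>2 * (norm t)\<^sup>2"
  unfolding power2_norm_eq_inner
  by (simp add: inner_add_left inner_add_right inner_commute[of t v] power2_eq_square algebra_simps)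

text \<open>
  The variance identity: it shows both that averaging does not increase mean squares and that the
  second moment dominates the variance.
\<close>

lemma sum_norm2_centered:
  fixes X :: "nat \<Rightarrow> 'a::real_inner"
  assumes "n > 0"
  defines "m \<equiv> (1 / real n) *\<^sub>R (\<Sum>i\<in>{1..n}. X i)"
  shows "(\<Sum>i\<in>{1..n}. (norm (X i - m))\<^sup>2) = (\<Sum>i\<in>{1..n}. (norm (X i))\<^sup>2) - real n * (norm m)\<^sup>2"
proof -
  have "(\<Sum>i\<in>{1..n}. (norm (X i - m))\<^sup>2)
      = (\<Sum>i\<in>{1..n}. (norm (X i))\<^sup>2 - 2 * (X i \<bullet> m) + (norm m)\<^sup>2)"
    by (intro sum.cong refl)
       (simp add: power2_norm_eq_inner inner_diff_left inner_diff_right inner_commute algebra_simps)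
  also have "\<dots> = (\<Sum>i\<in>{1..n}. (norm (X i))\<^sup>2) - 2 * ((\<Sum>i\<in>{1..n}. X i) \<bullet> m) + real n * (norm m)\<^sup>2"
    by (simp add: sum.distrib sum_subtractf sum_distrib_left inner_sum_left)
  also have "(\<Sum>i\<in>{1..n}. X i) = real n *\<^sub>R m"
    using assms by simp
  finally show ?thesis
    by (simp add: power2_norm_eq_inner)
qed

lemma norm2_mean_le:
  fixes X :: "nat \<Rightarrow> 'a::real_inner"
  assumes "n > 0"
  shows "(norm ((1 / real n) *\<^sub>R (\<Sum>i\<in>{1..n}. X i)))\<^sup>2 \<le> (1 / real n) * (\<Sum>i\<in>{1..n}. (norm (X i))\<^sup>2)"
proof -
  have "0 \<le> (\<Sum>i\<in>{1..n}. (norm (X i - (1 / real n) *\<^sub>R (\<Sum>i\<in>{1..n}. X i)))\<^sup>2)"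
    by (intro sum_nonneg) auto
  then show ?thesis
    unfolding sum_norm2_centered[OF assms] using assms by (simp add: field_simps)
qed

text \<open>
  The form in which sampling is used: \<open>v\<close> is the deterministic part of an update and \<open>c\<close> the step
  length. The cross term vanishes because the batch mean is unbiased. After centering, the off-diagonal
  part of \<open>sum_pairs_over_batches\<close> is zero, which leaves at most the variance of \<open>b\<close> independent
  samples.
\<close>

lemma batch_noise_second_moment:
  fixes X :: "nat \<Rightarrow> 'a::real_inner"
  assumes "b \<in> {1..n}"
  defines "m \<equiv> (1 / real n) *\<^sub>R (\<Sum>i\<in>{1..n}. X i)"
  shows "(\<Sum>S\<in>mini_batches n b. (norm (v + c *\<^sub>R ((1 / real b) *\<^sub>R (\<Sum>i\<in>S. X i) - m)))\<^sup>2) / real (n choose b)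
           \<le> (norm v)\<^sup>2 + c\<^sup>2 * ((1 / (real n * real b)) * (\<Sum>i\<in>{1..n}. (norm (X i))\<^sup>2))"
proof -
  define Y where "Y i = X i - m" for i
  define N where "N = real (n choose b)"
  have n: "n > 0" and b: "b > 0" and N: "N > 0"
    using assms by (auto simp: N_def)
  have Y0: "(\<Sum>i\<in>{1..n}. Y i) = 0"
    using n by (simp add: Y_def sum_subtractf m_def sum_constant_scaleR del: sum_constant)
  have first: "(\<Sum>S\<in>mini_batches n b. \<Sum>i\<in>S. Y i) = 0"
    using sum_over_batches[OF assms(1), of Y] Y0 by simp
  obtain c2 where c2: "0 \<le> c2"
    "(\<Sum>S\<in>mini_batches n b. \<Sum>i\<in>S. \<Sum>j\<in>S. Y i \<bullet> Y j)
       = (real b * N / real n - c2) * (\<Sum>i\<in>{1..n}. Y i \<bullet> Y i)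
         + c2 * (\<Sum>i\<in>{1..n}. \<Sum>j\<in>{1..n}. Y i \<bullet> Y j)"
    unfolding N_def by (rule sum_pairs_over_batches[OF assms(1), of "\<lambda>i j. Y i \<bullet> Y j"])
  have pairs: "(\<Sum>i\<in>A. \<Sum>j\<in>A. Y i \<bullet> Y j) = (norm (\<Sum>i\<in>A. Y i))\<^sup>2" for A
    by (simp only: power2_norm_eq_inner inner_sum_left) (simp only: inner_sum_right)
  have "(\<Sum>S\<in>mini_batches n b. (norm (\<Sum>i\<in>S. Y i))\<^sup>2)
      = (real b * N / real n - c2) * (\<Sum>i\<in>{1..n}. (norm (Y i))\<^sup>2)"
    using c2(2) unfolding pairs Y0 by (simp only: power2_norm_eq_inner) simp
  also have "\<dots> \<le> real b * N / real n * (\<Sum>i\<in>{1..n}. (norm (Y i))\<^sup>2)"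
    using c2(1) by (intro mult_right_mono sum_nonneg) auto
  also have "\<dots> \<le> real b * N / real n * (\<Sum>i\<in>{1..n}. (norm (X i))\<^sup>2)"
    using n N sum_norm2_centered[OF n, of X] by (intro mult_left_mono) (auto simp: Y_def m_def)
  finally have second: "(\<Sum>S\<in>mini_batches n b. (norm (\<Sum>i\<in>S. Y i))\<^sup>2)
      \<le> real b * N / real n * (\<Sum>i\<in>{1..n}. (norm (X i))\<^sup>2)" .
  have "(\<Sum>S\<in>mini_batches n b. (norm (v + c *\<^sub>R ((1 / real b) *\<^sub>R (\<Sum>i\<in>S. X i) - m)))\<^sup>2)
      = (\<Sum>S\<in>mini_batches n b. (norm (v + (c / real b) *\<^sub>R (\<Sum>i\<in>S. Y i)))\<^sup>2)"
  proof (rule sum.cong[OF refl])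
    fix S assume "S \<in> mini_batches n b"
    then have "card S = b"
      by (rule mini_batchesD)
    then have "(c / real b) *\<^sub>R (\<Sum>i\<in>S. Y i) = c *\<^sub>R ((1 / real b) *\<^sub>R (\<Sum>i\<in>S. X i) - m)"
      using b by (simp add: Y_def sum_subtractf sum_constant_scaleR scaleR_diff_right del: sum_constant)
    then show "(norm (v + c *\<^sub>R ((1 / real b) *\<^sub>R (\<Sum>i\<in>S. X i) - m)))\<^sup>2
        = (norm (v + (c / real b) *\<^sub>R (\<Sum>i\<in>S. Y i)))\<^sup>2"
      by simp
  qed
  also have "\<dots> = (\<Sum>S\<in>mini_batches n b. (norm v)\<^sup>2 + 2 * (c / real b) * (v \<bullet> (\<Sum>i\<in>S. Y i))
        + (c / real b)\<^sup>2 * (norm (\<Sum>i\<in>S. Y i))\<^sup>2)"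
    by (simp only: norm2_add_scaleR)
  also have "\<dots> = N * (norm v)\<^sup>2 + 2 * (c / real b) * (v \<bullet> (\<Sum>S\<in>mini_batches n b. \<Sum>i\<in>S. Y i))
        + (c / real b)\<^sup>2 * (\<Sum>S\<in>mini_batches n b. (norm (\<Sum>i\<in>S. Y i))\<^sup>2)"
    by (simp add: sum.distrib card_mini_batches N_def inner_sum_right sum_distrib_left)
  also have "\<dots> \<le> N * (norm v)\<^sup>2 + (c / real b)\<^sup>2 * (real b * N / real n * (\<Sum>i\<in>{1..n}. (norm (X i))\<^sup>2))"
    using mult_left_mono[OF second, of "(c / real b)\<^sup>2"] by (simp add: first)
  also have "\<dots> = N * ((norm v)\<^sup>2 + c\<^sup>2 * ((1 / (real n * real b)) * (\<Sum>i\<in>{1..n}. (norm (X i))\<^sup>2)))"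
    using n b by (simp add: field_simps power2_eq_square)
  finally show ?thesis
    using N by (simp add: N_def[symmetric] field_simps)
qed

section \<open>The iterates as a Markov chain with finitely many states\<close>

context prob_space
begin

lemma expectation_simple_function:
  fixes f :: "'b \<Rightarrow> real"
  assumes X: "simple_function M X" and T: "finite T" "X ` space M \<subseteq> T"
  shows "expectation (\<lambda>\<omega>. f (X \<omega>)) = (\<Sum>t\<in>T. prob {\<omega> \<in> space M. X \<omega> = t} * f t)"
proof -
  have ev: "{\<omega> \<in> space M. X \<omega> = t} \<in> events" for t
    using simple_functionD(2)[OF X, of "{t}"] by (simp add: vimage_def Int_def conj_commute)
  have "expectation (\<lambda>\<omega>. f (X \<omega>))
      = expectation (\<lambda>\<omega>. \<Sum>t\<in>T. indicator {\<omega> \<in> space M. X \<omega> = t} \<omega> * f t)"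
  proof (rule Bochner_Integration.integral_cong[OF refl])
    fix \<omega> assume "\<omega> \<in> space M"
    then have "(\<Sum>t\<in>T. indicator {\<omega> \<in> space M. X \<omega> = t} \<omega> * f t) = (\<Sum>t\<in>T. if t = X \<omega> then f t else 0)"
      by (intro sum.cong) (auto simp: indicator_def)
    also have "\<dots> = f (X \<omega>)"
      using T \<open>\<omega> \<in> space M\<close> by (subst sum.delta) auto
    finally show "f (X \<omega>) = (\<Sum>t\<in>T. indicator {\<omega> \<in> space M. X \<omega> = t} \<omega> * f t)"
      by simp
  qed
  also have "\<dots> = (\<Sum>t\<in>T. expectation (\<lambda>\<omega>. indicator {\<omega> \<in> space M. X \<omega> = t} \<omega> * f t))"
    by (rule Bochner_Integration.integral_sum)
       (intro integrable_mult_left integrable_real_indicator ev, simp add: less_top[symmetric])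
  also have "\<dots> = (\<Sum>t\<in>T. prob {\<omega> \<in> space M. X \<omega> = t} * f t)"
    by (intro sum.cong refl) (simp add: ev)
  finally show ?thesis .
qed

lemma integrable_of_simple_function:
  fixes f :: "'b \<Rightarrow> real"
  assumes "simple_function M X"
  shows "integrable M (\<lambda>\<omega>. f (X \<omega>))"
  by (rule integrable_simple_function) (auto intro: simple_function_compose1[OF assms])

end

context loopless_svrg
begin

abbreviation draw :: "nat \<Rightarrow> 'w \<Rightarrow> nat set \<times> bool" where
  "draw k \<omega> \<equiv> (B k \<omega>, coin k \<omega>)"

text \<open>
  The past is recorded as a list of draws, in order of time: its range is finite, and the
  iterates are obtained from it by a left fold.
\<close>

definition history :: "nat \<Rightarrow> 'w \<Rightarrow> (nat set \<times> bool) list" where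
  "history k \<omega> = map (\<lambda>j. draw j \<omega>) [0..<k]"

lemma history_Suc: "history (Suc k) \<omega> = history k \<omega> @ [draw k \<omega>]"
  by (simp add: history_def)

lemma draw_measurable: "draw k \<in> P \<rightarrow>\<^sub>M count_space UNIV"
  using draws_indep unfolding indep_vars_def by simp

lemma draw_range: "draw k ` space P \<subseteq> mini_batches n b \<times> UNIV"
  using batch_in by auto

lemma simple_draw: "simple_function P (draw k)"
proof -
  have "finite (draw k ` space P)"
    by (rule finite_subset[OF draw_range]) (simp add: finite_mini_batches)
  then show ?thesis
    unfolding simple_function_def using measurable_sets[OF draw_measurable] by simp
qed

lemma simple_history: "simple_function P (history k)"
proof (induction k)
  case 0
  show ?case
    by (simp add: history_def)
next
  case (Suc k)
  show ?case
    using simple_function_compose2[OF Suc simple_draw, of "\<lambda>h z. h @ [z]" k]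
    by (simp add: history_Suc[abs_def])
qed

lemma prob_history:
  assumes "length h = k"
  shows "prob {\<omega> \<in> space P. history k \<omega> = h} = (\<Prod>j<k. prob {\<omega> \<in> space P. draw j \<omega> = h ! j})"
proof (cases "k = 0")
  case True
  then show ?thesis
    using assms by (simp add: history_def prob_space)
next
  case False
  have "{\<omega> \<in> space P. history k \<omega> = h} = (\<Inter>j\<in>{..<k}. draw j -` {h ! j} \<inter> space P)"
    using assms False by (auto simp: history_def list_eq_iff_nth_eq)
  also have "prob \<dots> = (\<Prod>j\<in>{..<k}. prob (draw j -` {h ! j} \<inter> space P))"
    using False by (intro indep_varsD[OF draws_indep]) auto
  also have "\<dots> = (\<Prod>j<k. prob {\<omega> \<in> space P. draw j \<omega> = h ! j})"
    by (simp add: vimage_def Int_def conj_commute)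
  finally show ?thesis .
qed

text \<open>
  A new draw is independent of the whole past. A history fixes the value of each of its draws, so this
  is the product formula for independent variables, used once for \<open>k + 1\<close> and once for \<open>k\<close> draws.
\<close>

lemma prob_history_draw:
  "prob {\<omega> \<in> space P. history k \<omega> = h \<and> draw k \<omega> = z}
     = prob {\<omega> \<in> space P. history k \<omega> = h} * prob {\<omega> \<in> space P. draw k \<omega> = z}"
proof (cases "length h = k")
  case True
  have "prob {\<omega> \<in> space P. history k \<omega> = h \<and> draw k \<omega> = z} = prob {\<omega> \<in> space P. history (Suc k) \<omega> = h @ [z]}"
    by (simp add: history_Suc)
  also have "\<dots> = (\<Prod>j<Suc k. prob {\<omega> \<in> space P. draw j \<omega> = (h @ [z]) ! j})"
    using True by (intro prob_history) simp
  also have "\<dots> = (\<Prod>j<k. prob {\<omega> \<in> space P. draw j \<omega> = h ! j}) * prob {\<omega> \<in> space P. draw k \<omega> = z}"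
    using True by (simp add: nth_append)
  finally show ?thesis
    using prob_history[OF True] by simp
next
  case False
  then have "{\<omega> \<in> space P. history k \<omega> = h} = {}" "{\<omega> \<in> space P. history k \<omega> = h \<and> draw k \<omega> = z} = {}"
    by (auto simp: history_def)
  then show ?thesis
    by (simp only:) simp
qed

text \<open>
  The expectation over a single draw as an explicit finite average: \<open>n choose b\<close> equally likely
  batches, each combined with the two outcomes of the coin.
\<close>

definition draw_mean :: "(nat set \<Rightarrow> bool \<Rightarrow> real) \<Rightarrow> real" where
  "draw_mean f = (\<Sum>S\<in>mini_batches n b. p * f S True + (1 - p) * f S False) / real (n choose b)"

text \<open>
  The conditional expectation given the past, computed by hand: the joint law of past and draw
  factorizes, and both have finite range.
\<close>

lemma expectation_draw_history:
  fixes f :: "(nat set \<times> bool) list \<Rightarrow> nat set \<Rightarrow> bool \<Rightarrow> real"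
  assumes "b \<le> n" "0 \<le> p" "p \<le> 1"
  shows "expectation (\<lambda>\<omega>. f (history k \<omega>) (B k \<omega>) (coin k \<omega>))
           = expectation (\<lambda>\<omega>. draw_mean (f (history k \<omega>)))"
proof -
  let ?Z = "mini_batches n b \<times> (UNIV :: bool set)" and ?T = "history k ` space P"
  have T: "finite ?T" and Z: "finite ?Z"
    using simple_functionD(1)[OF simple_history] by (auto simp: finite_mini_batches)
  have ne: "mini_batches n b \<noteq> {}"
    using card_mini_batches[of n b] \<open>b \<le> n\<close> by force
  have law: "prob {\<omega> \<in> space P. draw k \<omega> = (S, c)} = (if c then p else 1 - p) / real (n choose b)"
    if "S \<in> mini_batches n b" for S c
  proof -
    have "prob {\<omega> \<in> space P. draw k \<omega> = (S, c)} = prob (draw k -` {(S, c)} \<inter> space P)"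
      by (simp add: vimage_def Int_def conj_commute)
    also have "\<dots> = measure (distr P (count_space UNIV) (draw k)) {(S, c)}"
      by (rule measure_distr[symmetric]) (auto intro: draw_measurable)
    also have "\<dots> = pmf (pair_pmf (pmf_of_set (mini_batches n b)) (bernoulli_pmf p)) (S, c)"
      by (simp add: draws_law pmf.rep_eq)
    also have "\<dots> = (if c then p else 1 - p) / real (n choose b)"
      using that ne assms by (cases c) (simp_all add: pmf_pair finite_mini_batches card_mini_batches)
    finally show ?thesis .
  qed
  have "expectation (\<lambda>\<omega>. f (history k \<omega>) (B k \<omega>) (coin k \<omega>))
      = expectation (\<lambda>\<omega>. (\<lambda>(h, S, c). f h S c) (history k \<omega>, draw k \<omega>))"
    by simp
  also have "\<dots> = (\<Sum>t\<in>?T \<times> ?Z. prob {\<omega> \<in> space P. (history k \<omega>, draw k \<omega>) = t} * (\<lambda>(h, S, c). f h S c) t)"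
    using draw_range T Z
    by (intro expectation_simple_function simple_function_Pair[OF simple_history simple_draw])
       (auto simp: image_subset_iff)
  also have "\<dots> = (\<Sum>h\<in>?T. \<Sum>z\<in>?Z. prob {\<omega> \<in> space P. history k \<omega> = h} * (prob {\<omega> \<in> space P. draw k \<omega> = z} * f h (fst z) (snd z)))"
    unfolding sum.cartesian_product
    by (intro sum.cong refl) (simp add: prob_history_draw split: prod.split)
  also have "\<dots> = (\<Sum>h\<in>?T. prob {\<omega> \<in> space P. history k \<omega> = h} * (\<Sum>z\<in>?Z. prob {\<omega> \<in> space P. draw k \<omega> = z} * f h (fst z) (snd z)))"
    by (simp only: sum_distrib_left)
  also have "\<dots> = (\<Sum>h\<in>?T. prob {\<omega> \<in> space P. history k \<omega> = h} * draw_mean (f h))"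
  proof (intro sum.cong refl arg_cong2[of _ _ _ _ "(*)"])
    fix h
    have "(\<Sum>z\<in>?Z. prob {\<omega> \<in> space P. draw k \<omega> = z} * f h (fst z) (snd z))
        = (\<Sum>S\<in>mini_batches n b. \<Sum>c\<in>UNIV. prob {\<omega> \<in> space P. draw k \<omega> = (S, c)} * f h S c)"
      unfolding sum.cartesian_product by (intro sum.cong refl) auto
    also have "\<dots> = (\<Sum>S\<in>mini_batches n b. \<Sum>c\<in>UNIV. (if c then p else 1 - p) / real (n choose b) * f h S c)"
      by (intro sum.cong refl) (simp only: law)
    also have "\<dots> = draw_mean (f h)"
      by (simp add: UNIV_bool draw_mean_def sum_divide_distrib add_divide_distrib add.commute)
    finally show "(\<Sum>z\<in>?Z. prob {\<omega> \<in> space P. draw k \<omega> = z} * f h (fst z) (snd z)) = draw_mean (f h)" .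
  qed
  also have "\<dots> = expectation (\<lambda>\<omega>. draw_mean (f (history k \<omega>)))"
    using simple_history T by (intro expectation_simple_function[symmetric]) auto
  finally show ?thesis .
qed

definition step :: "'a \<times> 'a \<times> 'a \<Rightarrow> nat set \<times> bool \<Rightarrow> 'a \<times> 'a \<times> 'a" where
  "step = (\<lambda>(y, z, u) (S, c). (y - \<eta> *\<^sub>R svrg_estimator n b G \<gamma> S u y z, y, if c then y else u))"

definition replay :: "(nat set \<times> bool) list \<Rightarrow> 'a \<times> 'a \<times> 'a" where
  "replay = foldl step (x0, x0, x0)"

lemma replay_history:
  assumes "\<omega> \<in> space P"
  shows "replay (history k \<omega>) = (x k \<omega>, x (k - 1) \<omega>, w k \<omega>)"
proof (induction k)
  case 0
  show ?case
    using assms by (simp add: replay_def history_def x_0 w_0)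
next
  case (Suc k)
  have "replay (history (Suc k) \<omega>) = step (replay (history k \<omega>)) (draw k \<omega>)"
    by (simp add: replay_def history_Suc)
  then show ?case
    using assms Suc by (simp add: step_def x_Suc w_Suc)
qed

lemma integrable_iterates:
  fixes f :: "'a \<Rightarrow> 'a \<Rightarrow> 'a \<Rightarrow> nat set \<Rightarrow> bool \<Rightarrow> real"
  shows "integrable P (\<lambda>\<omega>. f (x k \<omega>) (x (k - 1) \<omega>) (w k \<omega>) (B k \<omega>) (coin k \<omega>))"
proof -
  let ?g = "\<lambda>(h, S, c). case replay h of (y, z, u) \<Rightarrow> f y z u S c"
  have "integrable P (\<lambda>\<omega>. ?g (history k \<omega>, draw k \<omega>))"
    by (intro integrable_of_simple_function simple_function_Pair[OF simple_history simple_draw])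
  then show ?thesis
    by (rule Bochner_Integration.integrable_cong[THEN iffD1, rotated -1]) (auto simp: replay_history)
qed

lemma expectation_draw:
  fixes f :: "'a \<Rightarrow> 'a \<Rightarrow> 'a \<Rightarrow> nat set \<Rightarrow> bool \<Rightarrow> real"
  assumes "b \<le> n" "0 \<le> p" "p \<le> 1"
  shows "expectation (\<lambda>\<omega>. f (x k \<omega>) (x (k - 1) \<omega>) (w k \<omega>) (B k \<omega>) (coin k \<omega>))
           = expectation (\<lambda>\<omega>. draw_mean (f (x k \<omega>) (x (k - 1) \<omega>) (w k \<omega>)))"
proof -
  let ?f = "\<lambda>h. case replay h of (y, z, u) \<Rightarrow> f y z u"
  have "expectation (\<lambda>\<omega>. f (x k \<omega>) (x (k - 1) \<omega>) (w k \<omega>) (B k \<omega>) (coin k \<omega>))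
      = expectation (\<lambda>\<omega>. ?f (history k \<omega>) (B k \<omega>) (coin k \<omega>))"
    by (rule Bochner_Integration.integral_cong) (auto simp: replay_history)
  also have "\<dots> = expectation (\<lambda>\<omega>. draw_mean (?f (history k \<omega>)))"
    by (rule expectation_draw_history[OF assms])
  also have "\<dots> = expectation (\<lambda>\<omega>. draw_mean (f (x k \<omega>) (x (k - 1) \<omega>) (w k \<omega>)))"
    by (rule Bochner_Integration.integral_cong) (auto simp: replay_history)
  finally show ?thesis .
qed

lemma draw_mean_const:
  assumes "b \<le> n"
  shows "draw_mean (\<lambda>_ _. c) = c"
  using assms by (simp add: draw_mean_def card_mini_batches algebra_simps)

lemma draw_mean_le:
  assumes "b \<le> n" "\<And>S. S \<in> mini_batches n b \<Longrightarrow> p * f S True + (1 - p) * f S False \<le> c"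
  shows "draw_mean f \<le> c"
proof -
  have "(\<Sum>S\<in>mini_batches n b. p * f S True + (1 - p) * f S False) \<le> (\<Sum>S\<in>mini_batches n b. c)"
    by (intro sum_mono assms(2))
  then show ?thesis
    using \<open>b \<le> n\<close> by (simp add: draw_mean_def card_mini_batches divide_le_eq mult.commute)
qed

text \<open>
  Expectation of a function of the state at time \<open>k\<close>. Keeping the function as an argument lets the
  recursions be stated through \<open>transition\<close>.
\<close>

definition mean :: "nat \<Rightarrow> ('a \<Rightarrow> 'a \<Rightarrow> 'a \<Rightarrow> real) \<Rightarrow> real" where
  "mean k f = expectation (\<lambda>\<omega>. f (x k \<omega>) (x (k - 1) \<omega>) (w k \<omega>))"

text \<open>
  The Markov operator of the chain of triples (current iterate \<open>y\<close>, previous iterate \<open>z\<close>,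
  snapshot \<open>u\<close>).
\<close>

definition transition :: "('a \<Rightarrow> 'a \<Rightarrow> 'a \<Rightarrow> real) \<Rightarrow> 'a \<Rightarrow> 'a \<Rightarrow> 'a \<Rightarrow> real" where
  "transition f y z u =
     draw_mean (\<lambda>S c. f (y - \<eta> *\<^sub>R svrg_estimator n b G \<gamma> S u y z) y (if c then y else u))"

lemma integrable_state: "integrable P (\<lambda>\<omega>. f (x k \<omega>) (x (k - 1) \<omega>) (w k \<omega>))" for f :: "'a \<Rightarrow> 'a \<Rightarrow> 'a \<Rightarrow> real"
  using integrable_iterates[of "\<lambda>y z u _ _. f y z u" k] .

lemma mean_add: "mean k (\<lambda>y z u. f y z u + g y z u) = mean k f + mean k g"
  unfolding mean_def by (intro Bochner_Integration.integral_add integrable_state)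

lemma mean_diff: "mean k (\<lambda>y z u. f y z u - g y z u) = mean k f - mean k g"
  unfolding mean_def by (intro Bochner_Integration.integral_diff integrable_state)

lemma mean_mult: "mean k (\<lambda>y z u. c * f y z u) = c * mean k f"
  unfolding mean_def by simp

lemma mean_mono:
  assumes "\<And>y z u. f y z u \<le> g y z u"
  shows "mean k f \<le> mean k g"
  unfolding mean_def by (intro integral_mono integrable_state assms)

lemma mean_nonneg:
  assumes "\<And>y z u. 0 \<le> f y z u"
  shows "0 \<le> mean k f"
  unfolding mean_def using assms by (intro Bochner_Integration.integral_nonneg) auto

lemma mean_0: "mean 0 f = f x0 x0 x0"
proof -
  have "mean 0 f = expectation (\<lambda>\<omega>. f x0 x0 x0)"
    unfolding mean_def by (rule Bochner_Integration.integral_cong) (auto simp: x_0 w_0)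
  then show ?thesis
    by (simp add: prob_space)
qed

lemma mean_previous: "mean (Suc k) (\<lambda>y z u. f z) = mean k (\<lambda>y z u. f y)"
  by (simp add: mean_def)

text \<open>
  The Markov property. It reduces each recursion below to a pointwise inequality for
  \<^const>\<open>transition\<close>.
\<close>

lemma mean_Suc:
  assumes "b \<le> n" "0 \<le> p" "p \<le> 1"
  shows "mean (Suc k) f = mean k (transition f)"
proof -
  let ?f = "\<lambda>y z u S c. f (y - \<eta> *\<^sub>R svrg_estimator n b G \<gamma> S u y z) y (if c then y else u)"
  have "mean (Suc k) f
      = expectation (\<lambda>\<omega>. ?f (x k \<omega>) (x (k - 1) \<omega>) (w k \<omega>) (B k \<omega>) (coin k \<omega>))"
    unfolding mean_def by (rule Bochner_Integration.integral_cong) (auto simp: x_Suc w_Suc)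
  also have "\<dots> = expectation (\<lambda>\<omega>. draw_mean (?f (x k \<omega>) (x (k - 1) \<omega>) (w k \<omega>)))"
    by (rule expectation_draw[OF assms])
  finally show ?thesis
    by (simp add: mean_def transition_def)
qed

lemma expectation_component_evals:
  assumes "b \<le> n" "0 \<le> p" "p \<le> 1"
  shows "expectation (\<lambda>\<omega>. real (component_evals n b (\<lambda>k. coin k \<omega>) K))
           = real n + real K * (3 * real b + real n * p)"
proof -
  have coin: "expectation (\<lambda>\<omega>. if coin k \<omega> then real n else 0) = real n * p" for k
  proof -
    have "draw_mean (\<lambda>_ c. if c then real n else 0) = draw_mean (\<lambda>_ _. real n * p)"
      by (simp add: draw_mean_def algebra_simps)
    then show ?thesis
      using expectation_draw[OF assms, of "\<lambda>_ _ _ _ c. if c then real n else 0" k] assms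
      by (simp add: draw_mean_const prob_space)
  qed
  have int: "integrable P (\<lambda>\<omega>. if coin k \<omega> then real n else 0)" for k
    using integrable_iterates[of "\<lambda>_ _ _ _ c. if c then real n else 0" k] by simp
  have "(\<lambda>\<omega>. real (component_evals n b (\<lambda>k. coin k \<omega>) K))
      = (\<lambda>\<omega>. (real n + real K * (3 * real b)) + (\<Sum>k<K. if coin k \<omega> then real n else 0))"
    by (simp add: component_evals_def sum.distrib if_distrib[of real] add.assoc cong: if_cong)
  then show ?thesis
    by (simp add: Bochner_Integration.integral_add Bochner_Integration.integral_sum coin int
          prob_space algebra_simps)
qed

end

section \<open>Noise of the estimator and length of a step\<close>

lemma norm2_weighted_diff:
  fixes g h :: "'a::real_inner"
  shows "(norm (g - \<gamma> *\<^sub>R h))\<^sup>2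
           = (1 - \<gamma>) * (norm g)\<^sup>2 - \<gamma> * (1 - \<gamma>) * (norm h)\<^sup>2 + \<gamma> * (norm (g - h))\<^sup>2"
  unfolding power2_norm_eq_inner
  by (simp add: inner_diff_left inner_diff_right inner_commute[of h g] algebra_simps)

lemma norm2_add_le_double:
  fixes v t :: "'a::real_inner"
  shows "(norm (v - c *\<^sub>R t))\<^sup>2 \<le> 2 * (norm v)\<^sup>2 + 2 * c\<^sup>2 * (norm t)\<^sup>2"
proof -
  have "0 \<le> (norm (v + c *\<^sub>R t))\<^sup>2"
    by simp
  then show ?thesis
    using norm2_add_scaleR[of v c t] norm2_add_scaleR[of v "- c" t] by simp
qed

text \<open>
  Young's inequality with parameter \<open>p / (2 (1 - p))\<close>. The factor \<open>1 - p\<close> is the probability that the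
  snapshot is kept; half of the contraction that a refresh provides is spent on the cross term.
\<close>

lemma norm2_add_young:
  fixes v t :: "'a::real_inner" and p :: real
  assumes "0 < p" "p < 1"
  shows "(1 - p) * (norm (v + t))\<^sup>2
           \<le> (1 - p / 2) * (norm v)\<^sup>2 + (1 - p) * (2 - p) / p * (norm t)\<^sup>2"
proof -
  define a where "a = 2 * (1 - p) / p"
  have pa: "p * a = 2 * (1 - p)"
    using assms by (simp add: a_def)
  have "(1 - p / 2) * (norm v)\<^sup>2 + (1 - p) * (2 - p) / p * (norm t)\<^sup>2 - (1 - p) * (norm (v + t))\<^sup>2
      = (p / 2) * ((norm v)\<^sup>2 - 2 * a * (v \<bullet> t) + a\<^sup>2 * (norm t)\<^sup>2)"
    using assms unfolding a_def norm2_add_scaleR[of v 1 t, simplified]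
    by (simp add: field_simps power2_eq_square)
  also have "\<dots> = (p / 2) * (norm (v + (- a) *\<^sub>R t))\<^sup>2"
    by (simp only: norm2_add_scaleR) simp
  also have "\<dots> \<ge> 0"
    using assms by simp
  finally show ?thesis
    by simp
qed

locale lipschitz_svrg = loopless_svrg P n b p \<gamma> \<eta> G x0 B coin x w
  for P :: "'w measure" and n b :: nat and p \<gamma> \<eta> :: real
    and G :: "nat \<Rightarrow> 'a::real_inner \<Rightarrow> 'a" and x0 :: 'a
    and B :: "nat \<Rightarrow> 'w \<Rightarrow> nat set" and coin :: "nat \<Rightarrow> 'w \<Rightarrow> bool"
    and x w :: "nat \<Rightarrow> 'w \<Rightarrow> 'a" +
  fixes L :: real
  assumes batch_size: "b \<in> {1..n}"
    and refresh: "0 < p" "p < 1"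
    and lipschitz: "\<And>y z. (1 / real n) * (\<Sum>i\<in>{1..n}. (norm (G i y - G i z))\<^sup>2) \<le> L\<^sup>2 * (norm (y - z))\<^sup>2"
begin

abbreviation g :: "'a \<Rightarrow> 'a" where
  "g \<equiv> avg_op n G"

text \<open>
  The estimator is the batch average of these vectors plus a deterministic term, so they carry all its
  randomness. They are small when \<open>y\<close>, \<open>z\<close> and \<open>u\<close> are close to each other.
\<close>

definition residual :: "'a \<Rightarrow> 'a \<Rightarrow> 'a \<Rightarrow> nat \<Rightarrow> 'a" where
  "residual y z u i = G i y - \<gamma> *\<^sub>R G i z - (1 - \<gamma>) *\<^sub>R G i u"

text \<open>
  An upper bound for the variance of the estimator in state \<open>(y, z, u)\<close>.
\<close>

definition noise :: "'a \<Rightarrow> 'a \<Rightarrow> 'a \<Rightarrow> real" where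
  "noise y z u = (1 / (real n * real b)) * (\<Sum>i\<in>{1..n}. (norm (residual y z u i))\<^sup>2)"

lemma noise_nonneg: "0 \<le> noise y z u"
  unfolding noise_def by (intro mult_nonneg_nonneg sum_nonneg) auto

lemma lipschitz_mean_map: "(norm (g y - g z))\<^sup>2 \<le> L\<^sup>2 * (norm (y - z))\<^sup>2"
proof -
  have "g y - g z = (1 / real n) *\<^sub>R (\<Sum>i\<in>{1..n}. G i y - G i z)"
    by (simp add: avg_op_def sum_subtractf scaleR_diff_right)
  then show ?thesis
    using norm2_mean_le[of n "\<lambda>i. G i y - G i z"] lipschitz[of y z] batch_size by simp
qed

lemma estimator_decomposition:
  "svrg_estimator n b G \<gamma> S u y z = (g y - \<gamma> *\<^sub>R g z)
     + ((1 / real b) *\<^sub>R (\<Sum>i\<in>S. residual y z u i) - (1 / real n) *\<^sub>R (\<Sum>i\<in>{1..n}. residual y z u i))"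
proof -
  define \<beta> \<nu> where "\<beta> = 1 / real b" and "\<nu> = 1 / real n"
  have sums: "(\<Sum>i\<in>A. residual y z u i)
      = (\<Sum>i\<in>A. G i y) - \<gamma> *\<^sub>R (\<Sum>i\<in>A. G i z) - (1 - \<gamma>) *\<^sub>R (\<Sum>i\<in>A. G i u)" for A
    by (simp add: residual_def sum_subtractf scaleR_sum_right)
  show ?thesis
    unfolding svrg_estimator_def avg_op_def batch_op_def sums \<beta>_def[symmetric] \<nu>_def[symmetric]
    by (simp add: algebra_simps)
qed

text \<open>
  One step of a squared norm whose argument depends affinely on the new iterate. The shift \<open>f\<close> is
  minus the previous iterate when the step length is measured, and the reflection term minus the solution
  for the Lyapunov function.
\<close>

lemma transition_affine_norm2:
  "transition (\<lambda>y z u. (norm (y + f z))\<^sup>2) y z u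
           \<le> (norm (y - \<eta> *\<^sub>R (g y - \<gamma> *\<^sub>R g z) + f y))\<^sup>2 + \<eta>\<^sup>2 * noise y z u"
proof -
  define v where "v = y - \<eta> *\<^sub>R (g y - \<gamma> *\<^sub>R g z) + f y"
  define m where "m = (1 / real n) *\<^sub>R (\<Sum>i\<in>{1..n}. residual y z u i)"
  have "transition (\<lambda>y z u. (norm (y + f z))\<^sup>2) y z u
      = (\<Sum>S\<in>mini_batches n b. (norm (v + (- \<eta>) *\<^sub>R ((1 / real b) *\<^sub>R (\<Sum>i\<in>S. residual y z u i) - m)))\<^sup>2) / real (n choose b)"
    unfolding transition_def draw_mean_def estimator_decomposition v_def m_def
    by (simp add: algebra_simps)
  also have "\<dots> \<le> (norm v)\<^sup>2 + (- \<eta>)\<^sup>2 * noise y z u"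
    unfolding noise_def m_def by (rule batch_noise_second_moment[OF batch_size])
  finally show ?thesis
    by (simp add: v_def)
qed

text \<open>
  Weights of the latest and the preceding squared step in the noise recursion.
\<close>

definition C :: real where
  "C = (4 - 6 * p + 3 * p\<^sup>2) / (real b * p)"

definition C' :: real where
  "C' = 2 * \<gamma>\<^sup>2 * (2 - 3 * p + p\<^sup>2) / (real b * p)"

text \<open>
  When the snapshot is refreshed, each residual is just the increment of its component from \<open>y\<close> to
  \<open>y'\<close>. When it is kept, the residual changes by increments of the components over the last two steps,
  which \<open>norm2_add_young\<close> separates from the old residual.
\<close>

lemma noise_refresh:
  "p * noise y' y y + (1 - p) * noise y' y u
     \<le> (1 - p / 2) * noise y z u
       + C * (L\<^sup>2 * (norm (y' - y))\<^sup>2)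
       + C' * (L\<^sup>2 * (norm (y - z))\<^sup>2)"
proof -
  define \<alpha> where "\<alpha> = (1 - p) * (2 - p) / p"
  define s where "s v v' = (\<Sum>i\<in>{1..n}. (norm (G i v - G i v'))\<^sup>2)" for v v'
  have \<alpha>: "0 \<le> \<alpha>"
    using refresh by (simp add: \<alpha>_def)
  have n: "0 < real n" and b: "0 < real b"
    using batch_size by auto
  have pointwise: "p * (norm (residual y' y y i))\<^sup>2 + (1 - p) * (norm (residual y' y u i))\<^sup>2
      \<le> (1 - p / 2) * (norm (residual y z u i))\<^sup>2 + (p + 2 * \<alpha>) * (norm (G i y' - G i y))\<^sup>2
        + 2 * \<gamma>\<^sup>2 * \<alpha> * (norm (G i y - G i z))\<^sup>2" for i
  proof -
    let ?t = "(G i y' - G i y) - \<gamma> *\<^sub>R (G i y - G i z)"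
    have 1: "residual y' y y i = G i y' - G i y"
      by (simp add: residual_def algebra_simps)
    have 2: "residual y' y u i = residual y z u i + ?t"
      by (simp add: residual_def algebra_simps)
    have "(1 - p) * (norm (residual y' y u i))\<^sup>2
        \<le> (1 - p / 2) * (norm (residual y z u i))\<^sup>2 + \<alpha> * (norm ?t)\<^sup>2"
      unfolding 2 \<alpha>_def by (rule norm2_add_young[OF refresh])
    moreover have "\<alpha> * (norm ?t)\<^sup>2
        \<le> \<alpha> * (2 * (norm (G i y' - G i y))\<^sup>2 + 2 * \<gamma>\<^sup>2 * (norm (G i y - G i z))\<^sup>2)"
      by (intro mult_left_mono norm2_add_le_double \<alpha>)
    ultimately show ?thesis
      unfolding 1 by (simp add: algebra_simps)
  qed
  have "p * noise y' y y + (1 - p) * noise y' y u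
      = (1 / (real n * real b)) * (\<Sum>i\<in>{1..n}. p * (norm (residual y' y y i))\<^sup>2 + (1 - p) * (norm (residual y' y u i))\<^sup>2)"
    unfolding noise_def sum.distrib sum_distrib_left[symmetric] by (simp only: ring_distribs mult_ac)
  also have "\<dots> \<le> (1 / (real n * real b)) * (\<Sum>i\<in>{1..n}. (1 - p / 2) * (norm (residual y z u i))\<^sup>2
        + (p + 2 * \<alpha>) * (norm (G i y' - G i y))\<^sup>2 + 2 * \<gamma>\<^sup>2 * \<alpha> * (norm (G i y - G i z))\<^sup>2)"
    by (intro mult_left_mono sum_mono pointwise) simp
  also have "\<dots> = (1 - p / 2) * noise y z u + (p + 2 * \<alpha>) / real b * (1 / real n * s y' y)
        + 2 * \<gamma>\<^sup>2 * \<alpha> / real b * (1 / real n * s y z)"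
    unfolding noise_def s_def sum.distrib sum_distrib_left[symmetric] using n b
    by (simp add: field_simps)
  also have "\<dots> \<le> (1 - p / 2) * noise y z u + (p + 2 * \<alpha>) / real b * (L\<^sup>2 * (norm (y' - y))\<^sup>2)
        + 2 * \<gamma>\<^sup>2 * \<alpha> / real b * (L\<^sup>2 * (norm (y - z))\<^sup>2)"
    unfolding s_def using \<alpha> refresh
    by (intro add_mono order_refl mult_left_mono lipschitz) auto
  also have "(p + 2 * \<alpha>) / real b = C"
    using refresh b by (simp add: C_def \<alpha>_def field_simps power2_eq_square)
  also have "2 * \<gamma>\<^sup>2 * \<alpha> / real b = C'"
    using refresh b by (simp add: C'_def \<alpha>_def field_simps power2_eq_square)
  finally show ?thesis .
qed

lemma batch_le: "b \<le> n" "0 \<le> p" "p \<le> 1"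
  using batch_size refresh by auto

definition mean_sq_g :: "nat \<Rightarrow> real" where
  "mean_sq_g k = mean k (\<lambda>y z u. (norm (g y))\<^sup>2)"

definition mean_noise :: "nat \<Rightarrow> real" where
  "mean_noise k = mean k noise"

definition mean_sq_step :: "nat \<Rightarrow> real" where
  "mean_sq_step k = L\<^sup>2 * mean k (\<lambda>y z u. (norm (y - z))\<^sup>2)"

lemma mean_noise_Suc:
  "mean_noise (Suc k) \<le> (1 - p / 2) * mean_noise k + C * mean_sq_step (Suc k) + C' * mean_sq_step k"
proof -
  let ?f = "\<lambda>y z u. noise y z u - C * (L\<^sup>2 * (norm (y - z))\<^sup>2)"
  let ?h = "\<lambda>y z u. (1 - p / 2) * noise y z u + C' * (L\<^sup>2 * (norm (y - z))\<^sup>2)"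
  have refreshed: "p * ?f y' y y + (1 - p) * ?f y' y u \<le> ?h y z u" for y' y z u
    using noise_refresh[of y' y u z] by (simp add: algebra_simps)
  have "transition ?f y z u \<le> ?h y z u" for y z u
    unfolding transition_def
    by (intro draw_mean_le batch_le) (simp only: if_True if_False, rule refreshed)
  then have "mean (Suc k) ?f \<le> mean k ?h"
    unfolding mean_Suc[OF batch_le] by (rule mean_mono)
  then show ?thesis
    unfolding mean_add mean_diff mean_mult mean_noise_def mean_sq_step_def by simp
qed

lemma mean_sq_step_Suc:
  "mean_sq_step (Suc k) \<le> L\<^sup>2 * \<eta>\<^sup>2 * (mean k (\<lambda>y z u. (norm (g y - \<gamma> *\<^sub>R g z))\<^sup>2) + mean_noise k)"
proof -
  let ?N = "\<lambda>y z (u::'a). (norm (g y - \<gamma> *\<^sub>R g z))\<^sup>2"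
  have "transition (\<lambda>y z u. (norm (y - z))\<^sup>2) y z u \<le> \<eta>\<^sup>2 * ?N y z u + \<eta>\<^sup>2 * noise y z u" for y z u
    using transition_affine_norm2[of uminus y z u] by (simp add: power_mult_distrib)
  then have "mean (Suc k) (\<lambda>y z u. (norm (y - z))\<^sup>2) \<le> mean k (\<lambda>y z u. \<eta>\<^sup>2 * ?N y z u + \<eta>\<^sup>2 * noise y z u)"
    unfolding mean_Suc[OF batch_le] by (rule mean_mono)
  also have "\<dots> = \<eta>\<^sup>2 * (mean k ?N + mean_noise k)"
    unfolding mean_add mean_mult mean_noise_def by (simp add: algebra_simps)
  finally show ?thesis
    unfolding mean_sq_step_def mult.assoc by (rule mult_left_mono) simp
qed

end

section \<open>Descent of the distance to the solution\<close>

text \<open>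
  Here \<open>q = y - x\<^sup>\<star>\<close>, \<open>h = g y\<close> and \<open>h' = g z\<close>. The inner product \<open>h \<bullet> h'\<close> is expressed through
  \<open>\<parallel>h\<parallel>\<^sup>2 + \<parallel>h'\<parallel>\<^sup>2 - \<parallel>h - h'\<parallel>\<^sup>2\<close>, which produces the positive multiples of \<open>\<parallel>h\<parallel>\<^sup>2\<close> and \<open>\<parallel>h'\<parallel>\<^sup>2\<close> that pay
  for the negative Minty term.
\<close>

lemma reflected_step_distance:
  fixes q h h' :: "'a::real_inner"
  assumes minty: "- \<kappa> * (norm h)\<^sup>2 \<le> h \<bullet> q" and "\<gamma> \<le> 1" "0 \<le> \<eta>"
  shows "(norm (q + (\<gamma> * \<eta>) *\<^sub>R h' - ((1 - \<gamma>) * \<eta>) *\<^sub>R h))\<^sup>2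
           \<le> (norm (q + (\<gamma> * \<eta>) *\<^sub>R h'))\<^sup>2
             - (1 - \<gamma>) * \<eta> * (((2 * \<gamma> - 1) * \<eta> - 2 * \<kappa>) * (norm h)\<^sup>2
                 + \<gamma> * \<eta> * (norm h')\<^sup>2 - \<gamma> * \<eta> * (norm (h - h'))\<^sup>2)"
proof -
  define v where "v = q + (\<gamma> * \<eta>) *\<^sub>R h'"
  have polar: "2 * (h' \<bullet> h) = (norm h)\<^sup>2 + (norm h')\<^sup>2 - (norm (h - h'))\<^sup>2"
    by (simp add: power2_norm_eq_inner inner_diff_left inner_diff_right inner_commute[of h h'])
  have "2 * (v \<bullet> h) = 2 * (h \<bullet> q) + \<gamma> * \<eta> * (2 * (h' \<bullet> h))"
    by (simp add: v_def inner_add_left inner_commute[of h q])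
  also have "\<dots> \<ge> - 2 * \<kappa> * (norm h)\<^sup>2 + \<gamma> * \<eta> * ((norm h)\<^sup>2 + (norm h')\<^sup>2 - (norm (h - h'))\<^sup>2)"
    unfolding polar using minty by simp
  finally have "(1 - \<gamma>) * \<eta> * (- 2 * \<kappa> * (norm h)\<^sup>2 + \<gamma> * \<eta> * ((norm h)\<^sup>2 + (norm h')\<^sup>2 - (norm (h - h'))\<^sup>2))
      \<le> (1 - \<gamma>) * \<eta> * (2 * (v \<bullet> h))"
    using assms by (intro mult_left_mono) auto
  then show ?thesis
    using norm2_add_scaleR[of v "- ((1 - \<gamma>) * \<eta>)" h] unfolding v_def[symmetric]
    by (simp add: algebra_simps power2_eq_square)
qed

context lipschitz_svrg
begin

text \<open>
  For \<open>k = 0\<close> the previous iterate is the starting point itself.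
\<close>

definition mean_sq_prev_g :: "nat \<Rightarrow> real" where
  "mean_sq_prev_g k = mean k (\<lambda>y z u. (norm (g z))\<^sup>2)"

text \<open>
  The terms are grouped as the new iterate plus a function of the previous one, the form to which
  \<open>transition_affine_norm2\<close> applies.
\<close>

definition lyapunov :: "'a \<Rightarrow> nat \<Rightarrow> real" where
  "lyapunov xstar k = mean k (\<lambda>y z u. (norm (y + ((\<gamma> * \<eta>) *\<^sub>R g z - xstar)))\<^sup>2)"

lemma mean_sq_combination:
  assumes "0 \<le> \<gamma>" "\<gamma> \<le> 1"
  shows "mean k (\<lambda>y z u. (norm (g y - \<gamma> *\<^sub>R g z))\<^sup>2) \<le> (1 - \<gamma>) * mean_sq_g k + \<gamma> * mean_sq_step k"
proof -
  have "(norm (g y - \<gamma> *\<^sub>R g z))\<^sup>2 \<le> (1 - \<gamma>) * (norm (g y))\<^sup>2 + \<gamma> * (L\<^sup>2 * (norm (y - z))\<^sup>2)" for y z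
  proof -
    have "\<gamma> * (norm (g y - g z))\<^sup>2 \<le> \<gamma> * (L\<^sup>2 * (norm (y - z))\<^sup>2)"
      by (intro mult_left_mono lipschitz_mean_map assms)
    moreover have "0 \<le> \<gamma> * (1 - \<gamma>) * (norm (g z))\<^sup>2"
      using assms by simp
    ultimately show ?thesis
      unfolding norm2_weighted_diff by linarith
  qed
  then have "mean k (\<lambda>y z u. (norm (g y - \<gamma> *\<^sub>R g z))\<^sup>2)
      \<le> mean k (\<lambda>y z u. (1 - \<gamma>) * (norm (g y))\<^sup>2 + \<gamma> * (L\<^sup>2 * (norm (y - z))\<^sup>2))"
    by (rule mean_mono)
  then show ?thesis
    unfolding mean_add mean_mult mean_sq_g_def mean_sq_step_def .
qed

text \<open>
  The shift by \<open>\<gamma> \<eta> g z\<close> absorbs the reflection: the deterministic part of an update moves the shifted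
  point by \<open>- (1 - \<gamma>) \<eta> g y\<close>.
\<close>

lemma lyapunov_Suc:
  assumes minty: "\<And>y. - \<kappa> * (norm (g y))\<^sup>2 \<le> g y \<bullet> (y - xstar)"
    and "0 \<le> \<gamma>" "\<gamma> \<le> 1" "0 \<le> \<eta>"
  shows "lyapunov xstar (Suc k)
           \<le> lyapunov xstar k
             - (1 - \<gamma>) * \<eta> * (((2 * \<gamma> - 1) * \<eta> - 2 * \<kappa>) * mean_sq_g k
                 + \<gamma> * \<eta> * mean_sq_prev_g k - \<gamma> * \<eta> * mean_sq_step k)
             + \<eta>\<^sup>2 * mean_noise k"
proof -
  let ?z = "\<lambda>y z (u::'a). (norm (y + ((\<gamma> * \<eta>) *\<^sub>R g z - xstar)))\<^sup>2"
  let ?h = "\<lambda>y z u. ?z y z u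
             - ((1 - \<gamma>) * \<eta>) * (((2 * \<gamma> - 1) * \<eta> - 2 * \<kappa>) * (norm (g y))\<^sup>2
                 + (\<gamma> * \<eta>) * (norm (g z))\<^sup>2 - (\<gamma> * \<eta>) * (L\<^sup>2 * (norm (y - z))\<^sup>2))
             + \<eta>\<^sup>2 * noise y z u"
  have "transition ?z y z u \<le> ?h y z u" for y z u
  proof -
    let ?D = "(norm (g y - g z))\<^sup>2" and ?U = "L\<^sup>2 * (norm (y - z))\<^sup>2"
    let ?H = "((2 * \<gamma> - 1) * \<eta> - 2 * \<kappa>) * (norm (g y))\<^sup>2 + (\<gamma> * \<eta>) * (norm (g z))\<^sup>2"
    have "transition ?z y z u
        \<le> (norm (y - \<eta> *\<^sub>R (g y - \<gamma> *\<^sub>R g z) + ((\<gamma> * \<eta>) *\<^sub>R g y - xstar)))\<^sup>2 + \<eta>\<^sup>2 * noise y z u"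
      by (rule transition_affine_norm2)
    also have "y - \<eta> *\<^sub>R (g y - \<gamma> *\<^sub>R g z) + ((\<gamma> * \<eta>) *\<^sub>R g y - xstar)
        = (y - xstar) + (\<gamma> * \<eta>) *\<^sub>R g z - ((1 - \<gamma>) * \<eta>) *\<^sub>R g y"
      by (simp add: algebra_simps)
    also have "(norm \<dots>)\<^sup>2
        \<le> (norm ((y - xstar) + (\<gamma> * \<eta>) *\<^sub>R g z))\<^sup>2 - (1 - \<gamma>) * \<eta> * (?H - \<gamma> * \<eta> * ?D)"
      by (rule reflected_step_distance[OF minty assms(3,4)])
    also have "\<dots> \<le> (norm ((y - xstar) + (\<gamma> * \<eta>) *\<^sub>R g z))\<^sup>2 - (1 - \<gamma>) * \<eta> * (?H - \<gamma> * \<eta> * ?U)"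
      using assms by (intro diff_left_mono mult_left_mono lipschitz_mean_map) auto
    also have "(y - xstar) + (\<gamma> * \<eta>) *\<^sub>R g z = y + ((\<gamma> * \<eta>) *\<^sub>R g z - xstar)"
      by simp
    finally show ?thesis
      by simp
  qed
  then have "mean (Suc k) ?z \<le> mean k ?h"
    unfolding mean_Suc[OF batch_le] by (rule mean_mono)
  then show ?thesis
    unfolding mean_add mean_diff mean_mult lyapunov_def mean_sq_g_def mean_sq_prev_g_def
      mean_sq_step_def mean_noise_def .
qed

end

section \<open>Summing the recursions\<close>

text \<open>
  The sequences stand for the expectations of \<open>\<parallel>g (x k)\<parallel>\<^sup>2\<close>, \<open>\<parallel>g (x (k - 1))\<parallel>\<^sup>2\<close>, the squared step, the
  noise, \<open>\<parallel>g (x k) - \<gamma> g (x (k - 1))\<parallel>\<^sup>2\<close>, and the Lyapunov function divided by \<open>\<eta>\<^sup>2\<close>.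

  With \<open>A = \<Sum>k\<le>K. a k\<close> and \<open>S\<close> the sum of \<open>U\<close> up to \<open>K + 1\<close>, the noise up to \<open>K + 1\<close> is at most
  \<open>3 M S / 11\<close>, and \<open>8 M S / 11 \<le> A / 4 + 3 S / 4\<close>. So the noise is at most \<open>3 A / 32 + 9 S / 32\<close>, and its
  first part is the descent available from \<open>a\<close>. From \<open>a'\<close>, whose sum up to \<open>K + 1\<close> contains \<open>A\<close>, there
  remains \<open>3 A / 16\<close> against \<open>15 S / 32\<close>, where \<open>S \<le> 11 A / 255\<close> by \<open>M \<ge> 9\<close>.
\<close>

lemma telescoped_descent:
  fixes a a' U D N W :: "nat \<Rightarrow> real"
  assumes nonneg: "\<And>k. 0 \<le> a k" "\<And>k. 0 \<le> a' k" "\<And>k. 0 \<le> U k" "\<And>k. 0 \<le> D k" "\<And>k. 0 \<le> W k" "0 \<le> c'"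
    and init: "D 0 = 0" "U 0 = 0"
    and shift: "\<And>k. a' (Suc k) = a k"
    and noise: "\<And>k. D (Suc k) \<le> (1 - \<rho>) * D k + c * U (Suc k) + c' * U k"
    and \<rho>: "0 < \<rho>" "\<rho> \<le> 1"
    and M: "9 \<le> M" "11 * (c + c') / (3 * \<rho>) \<le> M"
    and move: "\<And>k. M * U (Suc k) \<le> N k + D k"
    and comb: "\<And>k. N k \<le> a k / 4 + 3 / 4 * U k"
    and descent: "\<And>k. W (Suc k) \<le> W k - (3 / 32 * a k + 3 / 16 * a' k - 3 / 16 * U k) + D k"
  shows "(\<Sum>k\<le>K. a k) \<le> 6 * W 0"
proof -
  have noise_sum: "(\<Sum>k\<le>J. D k) \<le> 3 / 11 * M * (\<Sum>k\<le>J. U k)" for J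
  proof -
    have "D J + \<rho> * (\<Sum>k<J. D k) \<le> c * (\<Sum>k\<le>J. U k) + c' * (\<Sum>k<J. U k)"
    proof (induction J)
      case 0
      show ?case
        by (simp add: init)
    next
      case (Suc J)
      show ?case
        using Suc noise[of J] by (simp add: algebra_simps lessThan_Suc_atMost[symmetric])
    qed
    moreover have "\<rho> * D J \<le> D J"
      using \<rho> nonneg(4)[of J] by (simp add: mult_left_le_one_le)
    moreover have "c' * (\<Sum>k<J. U k) \<le> c' * (\<Sum>k\<le>J. U k)"
      using nonneg by (intro mult_left_mono) (auto simp: lessThan_Suc_atMost[symmetric])
    ultimately have "\<rho> * (\<Sum>k\<le>J. D k) \<le> (c + c') * (\<Sum>k\<le>J. U k)"
      by (simp add: algebra_simps lessThan_Suc_atMost[symmetric])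
    also have "\<dots> \<le> (\<rho> * (3 / 11 * M)) * (\<Sum>k\<le>J. U k)"
      using M \<rho> nonneg by (intro mult_right_mono sum_nonneg) (auto simp: field_simps)
    finally show ?thesis
      using \<rho> by (simp add: mult.assoc)
  qed
  define A where "A = (\<Sum>k\<le>K. a k)"
  define S where "S = (\<Sum>k\<le>Suc K. U k)"
  define T where "T = (\<Sum>k\<le>K. U k)"
  have T: "T \<le> S" "0 \<le> T"
    using nonneg by (auto simp: S_def T_def sum_nonneg)
  have "M * S = (\<Sum>k\<le>K. M * U (Suc k))"
    by (simp add: S_def sum.atMost_Suc_shift init sum_distrib_left del: sum.atMost_Suc)
  also have "\<dots> \<le> (\<Sum>k\<le>K. (a k / 4 + 3 / 4 * U k) + D k)"
    using move comb by (intro sum_mono) (smt (verit))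
  also have "\<dots> = A / 4 + 3 / 4 * T + (\<Sum>k\<le>K. D k)"
    by (simp add: A_def T_def sum.distrib sum_divide_distrib sum_distrib_left)
  also have "(\<Sum>k\<le>K. D k) \<le> 3 / 11 * M * T"
    using noise_sum by (simp add: T_def)
  also have "\<dots> \<le> 3 / 11 * M * S"
    using T M by (intro mult_left_mono) auto
  finally have MS: "8 / 11 * (M * S) \<le> A / 4 + 3 / 4 * T"
    by simp
  have "9 * S \<le> M * S"
    using M T by (intro mult_right_mono) auto
  then have S: "S \<le> 11 / 255 * A"
    using MS T by simp
  have "W (Suc J) + (\<Sum>k\<le>J. 3 / 32 * a k + 3 / 16 * a' k - 3 / 16 * U k) \<le> W 0 + (\<Sum>k\<le>J. D k)" for J
  proof (induction J)
    case 0
    show ?case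
      using descent[of 0] by simp
  next
    case (Suc J)
    then show ?case
      using descent[of "Suc J"] by simp
  qed
  \<comment> \<open>The descent is summed one step beyond \<open>K\<close>, so that the shifted sum of \<open>a'\<close> covers \<open>a K\<close>.\<close>
  from this[of "Suc K"]
  have "3 / 32 * (\<Sum>k\<le>Suc K. a k) + 3 / 16 * (\<Sum>k\<le>Suc K. a' k) \<le> W 0 + (\<Sum>k\<le>Suc K. D k) + 3 / 16 * S"
    using nonneg(5)[of "Suc (Suc K)"]
    by (simp add: sum.distrib sum_subtractf S_def sum_distrib_left del: sum.atMost_Suc)
  moreover have "A \<le> (\<Sum>k\<le>Suc K. a' k)"
    using nonneg(2)[of 0] by (simp add: A_def sum.atMost_Suc_shift shift del: sum.atMost_Suc)
  moreover have "A \<le> (\<Sum>k\<le>Suc K. a k)"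
    using nonneg(1)[of "Suc K"] by (simp add: A_def)
  moreover have "(\<Sum>k\<le>Suc K. D k) \<le> 3 / 11 * (M * S)"
    using noise_sum[of "Suc K"] by (simp only: S_def mult.assoc)
  moreover have "0 \<le> A"
    using nonneg by (simp add: A_def sum_nonneg)
  ultimately have "A \<le> 6 * W 0"
    using MS S T by linarith
  then show ?thesis
    by (simp add: A_def)
qed

text \<open>
  Multiplied by \<open>b p\<^sup>2\<close>, the constant becomes \<open>57 b p\<^sup>2 / 24\<close> plus \<open>22 / 3\<close> times a quadratic in \<open>p\<close> that
  decreases from \<open>25 / 4\<close> at \<open>p = 0\<close> to \<open>1\<close> at \<open>p = 1\<close>; the two ends give the two bounds.
\<close>

lemma step_constant_bounds:
  fixes b p M :: real
  assumes "0 < p" "p < 1" "0 < b" "b * p\<^sup>2 \<le> 1"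
    and M: "M = 57 / 24 + 11 * ((4 - 6 * p + 3 * p\<^sup>2) / (b * p)
              + 2 * (3 / 4)\<^sup>2 * (2 - 3 * p + p\<^sup>2) / (b * p)) / (3 * (p / 2))"
  shows "9 \<le> M" "M * (b * p\<^sup>2) \<le> 1157 / 24"
proof -
  define s where "s = b * p\<^sup>2"
  define Q where "Q = 25 / 4 - 75 / 8 * p + 33 / 8 * p\<^sup>2"
  have s: "0 < s" "s \<le> 1"
    using assms by (auto simp: s_def)
  have Ms: "M * s = 57 / 24 * s + 22 / 3 * Q"
    using assms(1,3) unfolding M s_def Q_def by (simp add: field_simps power2_eq_square)
  have "0 \<le> (1 - p) * (42 - 33 * p)"
    using assms(1,2) by (intro mult_nonneg_nonneg) auto
  then have Q1: "1 \<le> Q"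
    by (simp add: Q_def algebra_simps power2_eq_square)
  have "p * p \<le> 1 * p"
    using assms(1,2) by (intro mult_right_mono) auto
  then have Q2: "Q \<le> 25 / 4"
    using assms(1) by (simp add: Q_def power2_eq_square)
  have "9 * s \<le> M * s"
    unfolding Ms using Q1 s by simp
  then show "9 \<le> M"
    using s by simp
  have "M * s \<le> 1157 / 24"
    unfolding Ms using Q2 s by simp
  then show "M * (b * p\<^sup>2) \<le> 1157 / 24"
    by (simp add: s_def)
qed

context lipschitz_svrg
begin

text \<open>
  The factor \<open>75 / 8\<close> is \<open>6\<close>, from \<open>telescoped_descent\<close>, times \<open>(5 / 4)\<^sup>2\<close>, from the initial shifted
  point: \<open>\<parallel>g x0\<parallel> \<le> L \<parallel>x0 - x\<^sup>\<star>\<parallel>\<close> and \<open>\<eta> L \<le> 1 / 3\<close> bound the shift by a quarter of the initial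
  distance.
\<close>

lemma sum_mean_sq_le:
  assumes \<gamma>: "\<gamma> = 3 / 4"
    and L: "0 < L"
    and root: "g xstar = 0"
    and minty: "\<And>y. - \<kappa> * (norm (g y))\<^sup>2 \<le> g y \<bullet> (y - xstar)"
    and batch: "real b * p\<^sup>2 \<le> 1"
    and M: "M = 57 / 24 + 11 * (C + C') / (3 * (p / 2))"
    and \<kappa>: "L * \<kappa> \<le> 1 / (16 * sqrt M)"
    and \<eta>: "\<eta> = 1 / (L * sqrt M)"
  shows "(\<Sum>k\<le>K. mean_sq_g k) \<le> 75 / 8 * M * (L\<^sup>2 * (norm (x0 - xstar))\<^sup>2)"
proof -
  let ?R = "norm (x0 - xstar)"
  have b: "0 < real b"
    using batch_size by simp
  have M9: "9 \<le> M"
    by (rule step_constant_bounds(1)[OF refresh b batch M[unfolded C_def C'_def, unfolded \<gamma>]])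
  then have sqrtM: "3 \<le> sqrt M"
    by (simp add: real_le_rsqrt)
  have \<eta>_pos: "0 < \<eta>"
    using L M9 by (simp add: \<eta>)
  have \<eta>2: "L\<^sup>2 * \<eta>\<^sup>2 * M = 1" "1 / \<eta>\<^sup>2 = M * L\<^sup>2"
    using L M9 by (simp_all add: \<eta> power_divide power_mult_distrib)
  have "L * (16 * \<kappa>) \<le> L * \<eta>"
    using \<kappa> L by (simp add: \<eta>)
  then have \<kappa>\<eta>: "\<kappa> \<le> \<eta> / 16"
    using L by simp
  have C'_nonneg: "0 \<le> C'"
  proof -
    have "0 \<le> (1 - p) * (2 - p)"
      using refresh by simp
    then have "0 \<le> 2 - 3 * p + p\<^sup>2"
      by (simp add: algebra_simps power2_eq_square)
    then show ?thesis
      unfolding C'_def using refresh b by (intro divide_nonneg_nonneg mult_nonneg_nonneg) auto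
  qed
  have "(\<Sum>k\<le>K. mean_sq_g k) \<le> 6 * (lyapunov xstar 0 / \<eta>\<^sup>2)"
  proof (rule telescoped_descent[where a' = mean_sq_prev_g and U = mean_sq_step and D = mean_noise
        and W = "\<lambda>k. lyapunov xstar k / \<eta>\<^sup>2" and c = C and c' = C' and \<rho> = "p / 2" and M = M
        and N = "\<lambda>k. mean k (\<lambda>y z u. (norm (g y - \<gamma> *\<^sub>R g z))\<^sup>2)"])
    show nonneg: "0 \<le> mean_sq_g k" "0 \<le> mean_sq_prev_g k" "0 \<le> mean_sq_step k" "0 \<le> mean_noise k"
      "0 \<le> lyapunov xstar k / \<eta>\<^sup>2" for k
      unfolding mean_sq_g_def mean_sq_prev_g_def mean_sq_step_def mean_noise_def lyapunov_def
      by (auto intro!: mean_nonneg noise_nonneg mult_nonneg_nonneg divide_nonneg_nonneg)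
    show "mean_noise 0 = 0" "mean_sq_step 0 = 0"
      by (simp_all add: mean_noise_def mean_sq_step_def mean_0 noise_def residual_def algebra_simps)
    show "mean_sq_prev_g (Suc k) = mean_sq_g k" for k
      by (simp add: mean_sq_prev_g_def mean_sq_g_def mean_previous)
    show "mean_noise (Suc k) \<le> (1 - p / 2) * mean_noise k + C * mean_sq_step (Suc k) + C' * mean_sq_step k" for k
      by (rule mean_noise_Suc)
    show "M * mean_sq_step (Suc k) \<le> mean k (\<lambda>y z u. (norm (g y - \<gamma> *\<^sub>R g z))\<^sup>2) + mean_noise k" for k
    proof -
      let ?s = "mean k (\<lambda>y z u. (norm (g y - \<gamma> *\<^sub>R g z))\<^sup>2) + mean_noise k"
      have "M * mean_sq_step (Suc k) \<le> M * (L\<^sup>2 * \<eta>\<^sup>2 * ?s)"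
        using M9 by (intro mult_left_mono mean_sq_step_Suc) auto
      also have "\<dots> = (L\<^sup>2 * \<eta>\<^sup>2 * M) * ?s"
        by (simp only: mult_ac)
      finally show ?thesis
        by (simp add: \<eta>2)
    qed
    show "mean k (\<lambda>y z u. (norm (g y - \<gamma> *\<^sub>R g z))\<^sup>2) \<le> mean_sq_g k / 4 + 3 / 4 * mean_sq_step k" for k
      using mean_sq_combination[of k] by (simp add: \<gamma>)
    show "lyapunov xstar (Suc k) / \<eta>\<^sup>2 \<le> lyapunov xstar k / \<eta>\<^sup>2
        - (3 / 32 * mean_sq_g k + 3 / 16 * mean_sq_prev_g k - 3 / 16 * mean_sq_step k) + mean_noise k" for k
    proof -
      have "3 / 8 * \<eta> * mean_sq_g k \<le> (\<eta> / 2 - 2 * \<kappa>) * mean_sq_g k"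
        using \<kappa>\<eta> nonneg(1)[of k] by (intro mult_right_mono) auto
      then have "\<eta> / 4 * (3 / 8 * \<eta> * mean_sq_g k + 3 / 4 * \<eta> * mean_sq_prev_g k - 3 / 4 * \<eta> * mean_sq_step k)
          \<le> \<eta> / 4 * ((\<eta> / 2 - 2 * \<kappa>) * mean_sq_g k + 3 / 4 * \<eta> * mean_sq_prev_g k - 3 / 4 * \<eta> * mean_sq_step k)"
        using \<eta>_pos by (intro mult_left_mono) auto
      also have "\<dots> = (1 - \<gamma>) * \<eta> * (((2 * \<gamma> - 1) * \<eta> - 2 * \<kappa>) * mean_sq_g k
          + \<gamma> * \<eta> * mean_sq_prev_g k - \<gamma> * \<eta> * mean_sq_step k)"
        by (simp add: \<gamma>)
      also have "\<dots> \<le> lyapunov xstar k - lyapunov xstar (Suc k) + \<eta>\<^sup>2 * mean_noise k"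
      proof -
        have "0 \<le> \<gamma>" "\<gamma> \<le> 1"
          by (simp_all add: \<gamma>)
        then show ?thesis
          using lyapunov_Suc[OF minty, of k] \<eta>_pos by linarith
      qed
      finally have "lyapunov xstar (Suc k) \<le> lyapunov xstar k
          - \<eta> / 4 * (3 / 8 * \<eta> * mean_sq_g k + 3 / 4 * \<eta> * mean_sq_prev_g k - 3 / 4 * \<eta> * mean_sq_step k)
          + \<eta>\<^sup>2 * mean_noise k"
        by linarith
      also have "\<dots> = \<eta>\<^sup>2 * (lyapunov xstar k / \<eta>\<^sup>2
        - (3 / 32 * mean_sq_g k + 3 / 16 * mean_sq_prev_g k - 3 / 16 * mean_sq_step k) + mean_noise k)"
        using \<eta>_pos by (simp add: field_simps power2_eq_square)
      finally show ?thesis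
        using \<eta>_pos by (simp add: pos_divide_le_eq mult.commute)
    qed
  qed (use refresh M M9 C'_nonneg in auto)
  also have "lyapunov xstar 0 / \<eta>\<^sup>2 \<le> (5 / 4 * ?R)\<^sup>2 / \<eta>\<^sup>2"
  proof (intro divide_right_mono)
    have "(norm (g x0))\<^sup>2 \<le> (L * ?R)\<^sup>2"
      using lipschitz_mean_map[of x0 xstar] root by (simp add: power_mult_distrib)
    then have "norm (g x0) \<le> L * ?R"
      using L by (rule_tac power2_le_imp_le) auto
    then have "\<eta> * norm (g x0) \<le> \<eta> * (L * ?R)"
      using \<eta>_pos by (intro mult_left_mono) auto
    also have "\<dots> = 1 / sqrt M * ?R"
      using L by (simp add: \<eta>)
    also have "\<dots> \<le> 1 / 3 * ?R"
      using sqrtM M9 by (intro mult_right_mono divide_left_mono) auto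
    finally have "norm ((x0 - xstar) + (3 / 4 * \<eta>) *\<^sub>R g x0) \<le> 5 / 4 * ?R"
      using norm_triangle_ineq[of "x0 - xstar" "(3 / 4 * \<eta>) *\<^sub>R g x0"] \<eta>_pos by simp
    moreover have "lyapunov xstar 0 = (norm ((x0 - xstar) + (3 / 4 * \<eta>) *\<^sub>R g x0))\<^sup>2"
    proof -
      have "lyapunov xstar 0 = (norm (x0 + ((\<gamma> * \<eta>) *\<^sub>R g x0 - xstar)))\<^sup>2"
        by (simp only: lyapunov_def mean_0)
      also have "x0 + ((\<gamma> * \<eta>) *\<^sub>R g x0 - xstar) = (x0 - xstar) + (3 / 4 * \<eta>) *\<^sub>R g x0"
        by (simp add: \<gamma>)
      finally show ?thesis .
    qed
    ultimately show "lyapunov xstar 0 \<le> (5 / 4 * ?R)\<^sup>2"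
      by (simp only: power_mono norm_ge_zero)
  qed simp
  also have "6 * ((5 / 4 * ?R)\<^sup>2 / \<eta>\<^sup>2) = 75 / 8 * ?R\<^sup>2 * (1 / \<eta>\<^sup>2)"
    by (simp add: power2_eq_square)
  also have "\<dots> = 75 / 8 * M * (L\<^sup>2 * ?R\<^sup>2)"
    unfolding \<eta>2 by simp
  finally show ?thesis
    by simp
qed

end

text \<open>
  Here \<open>t\<close> is \<open>n powr (2 / 3)\<close>, which is both the expected refresh cost per iteration and at most twice the batch
  size, so an iteration costs at most \<open>5 b\<close>. If the least \<open>K\<close> with the first property is
  positive, it is below \<open>452 Q t / b\<close>, so the cost is at most \<open>5 * 452 * Q t = 2260 Q t\<close>. Moreover
  \<open>452 Q t > b \<ge> 1\<close> then, and the remaining \<open>664 Q t\<close> exceeds the unit that the floor may lose.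
\<close>

lemma iteration_budget:
  fixes Q t b :: real
  assumes "0 \<le> Q" "0 \<le> t" "1 \<le> b" "t \<le> 2 * b"
  obtains K :: nat where "452 * Q * t / b \<le> real K + 1"
    and "real K * (t + 3 * b) \<le> of_int \<lfloor>2924 * Q * t\<rfloor>"
proof (cases "452 * Q * t / b \<le> 1")
  case True
  then show ?thesis
    using that[of 0] assms by simp
next
  case False
  define r where "r = 452 * Q * t / b"
  define K where "K = nat \<lceil>r\<rceil> - 1"
  have r: "1 < r"
    using False by (simp add: r_def)
  then have r1: "1 \<le> \<lceil>r\<rceil>"
    by linarith
  then have "int (Suc K) = \<lceil>r\<rceil>"
    unfolding K_def by linarith
  then have K1: "real K + 1 = of_int \<lceil>r\<rceil>"
    by linarith
  then have "real K \<le> r"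
    by linarith
  then have "real K * (t + 3 * b) \<le> r * (5 * b)"
    using assms r by (intro mult_mono) auto
  also have "\<dots> = 2260 * (Q * t)"
    using assms by (simp add: r_def)
  also have "\<dots> \<le> 2924 * Q * t - 1"
  proof -
    have "b < 452 * (Q * t)"
      using r assms by (simp add: r_def less_divide_eq)
    then show ?thesis
      using assms by simp
  qed
  also have "\<dots> \<le> of_int \<lfloor>2924 * Q * t\<rfloor>"
    by linarith
  finally have "real K * (t + 3 * b) \<le> of_int \<lfloor>2924 * Q * t\<rfloor>" .
  moreover have "r \<le> real K + 1"
    using K1 by linarith
  ultimately show ?thesis
    using that unfolding r_def by blast
qed

theorem corollary3p2:
  fixes P :: "'w measure"
    and n b :: nat
    and G :: "nat \<Rightarrow> real ^ 'd \<Rightarrow> real ^ 'd"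
    and L \<kappa> p \<gamma> \<eta> \<rho> C C' M R\<^sub>0 :: real
    and xstar x0 :: "real ^ 'd"
    and B :: "nat \<Rightarrow> 'w \<Rightarrow> nat set"
    and coin :: "nat \<Rightarrow> 'w \<Rightarrow> bool"
    and x w :: "nat \<Rightarrow> 'w \<Rightarrow> real ^ 'd"
  assumes "{z. avg_op n G z = 0} \<noteq> {}"
    and "L > 0"
    and "\<And>y z. (1 / real n) * (\<Sum>i\<in>{1..n}. (norm (G i y - G i z))\<^sup>2) \<le> L\<^sup>2 * (norm (y - z))\<^sup>2"
    and "avg_op n G xstar = 0"
    and "\<kappa> \<ge> 0"
    and "\<And>y. avg_op n G y \<bullet> (y - xstar) \<ge> - \<kappa> * (norm (avg_op n G y))\<^sup>2"
    and "b \<in> {1..n}"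
    and "0 < p" and "p < 1"
    and "real b * p\<^sup>2 \<le> 1"
    and "\<gamma> = 3 / 4"
    and "\<rho> = p / 2"
    and "C = (4 - 6 * p + 3 * p\<^sup>2) / (real b * p)"
    and "C' = 2 * \<gamma>\<^sup>2 * (2 - 3 * p + p\<^sup>2) / (real b * p)"
    and "M = 57 / 24 + 11 * (C + C') / (3 * \<rho>)"
    and "L * \<kappa> \<le> 1 / (16 * sqrt M)"
    and "\<eta> = 1 / (L * sqrt M)"
    and "loopless_svrg P n b p \<gamma> \<eta> G x0 B coin x w"
    and "R\<^sub>0 = norm (x0 - xstar)"
  shows "\<eta> \<ge> 0.1440 * sqrt (real b) * p / L
    \<and> (\<forall>K. (1 / (real K + 1)) * (\<Sum>k\<le>K. \<integral>\<omega>. (norm (avg_op n G (x k \<omega>)))\<^sup>2 \<partial>P)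
          \<le> 526 * L\<^sup>2 * (norm (x0 - xstar))\<^sup>2 / (real b * p\<^sup>2 * (real K + 1)))
    \<and> (n \<ge> 2 \<and> p = real n powr (- 1 / 3) \<and> int b = \<lfloor>real n powr (2 / 3)\<rfloor> \<longrightarrow>
        (\<forall>\<epsilon>>0. \<exists>K.
          (1 / (real K + 1)) * (\<Sum>k\<le>K. \<integral>\<omega>. (norm (avg_op n G (x k \<omega>)))\<^sup>2 \<partial>P) \<le> \<epsilon>\<^sup>2
          \<and> (\<integral>\<omega>. real (component_evals n b (\<lambda>k. coin k \<omega>) K) \<partial>P)
              \<le> real n + of_int \<lfloor>4 * 731 * L\<^sup>2 * R\<^sub>0\<^sup>2 * real n powr (2 / 3) / \<epsilon>\<^sup>2\<rfloor>))"
proof -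
  note L = assms(2) and batch_size = assms(7) and p = assms(8,9) and batch = assms(10)
  interpret S: lipschitz_svrg P n b p \<gamma> \<eta> G x0 B coin x w L
    by (rule lipschitz_svrg.intro[OF assms(18)], unfold_locales) (rule assms(7) assms(8) assms(9) assms(3))+
  have b: "0 < real b"
    using batch_size by simp
  have M: "M = 57 / 24 + 11 * (S.C + S.C') / (3 * (p / 2))"
    using assms(15) unfolding assms(12-14) S.C_def S.C'_def .
  note M_bounds = step_constant_bounds[OF p b batch M[unfolded S.C_def S.C'_def, unfolded assms(11)]]
  have bp: "0 < real b * p\<^sup>2"
    using p b by simp
  define E where "E K = (\<Sum>k\<le>K. \<integral>\<omega>. (norm (avg_op n G (x k \<omega>)))\<^sup>2 \<partial>P)" for K
  define D where "D = L\<^sup>2 * R\<^sub>0\<^sup>2"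
  have D: "0 \<le> D"
    by (simp add: D_def)
  \<comment> \<open>\<open>75 / 8 * 1157 / 24\<close> is about \<open>451.95\<close>.\<close>
  have E: "E K \<le> 452 * D / (real b * p\<^sup>2)" for K
  proof -
    have "E K = (\<Sum>k\<le>K. S.mean_sq_g k)"
      by (simp add: E_def S.mean_sq_g_def S.mean_def)
    also have "\<dots> \<le> 75 / 8 * M * (L\<^sup>2 * (norm (x0 - xstar))\<^sup>2)"
      using assms(6) by (intro S.sum_mean_sq_le[OF assms(11) L assms(4) _ batch M assms(16,17)]) simp
    also have "\<dots> = 75 / 8 * (M * (real b * p\<^sup>2)) * D / (real b * p\<^sup>2)"
      using p b by (simp add: D_def assms(19))
    also have "\<dots> \<le> 452 * D / (real b * p\<^sup>2)"
      using M_bounds(2) D bp by (intro divide_right_mono mult_right_mono) auto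
    finally show ?thesis .
  qed
  have "0.1440 * sqrt (real b) * p / L \<le> \<eta>"
  proof -
    \<comment> \<open>\<open>0.1440 = 18 / 125\<close>, and \<open>0.1440\<^sup>2 * 1157 / 24\<close> is about \<open>0.9997\<close>.\<close>
    have "(18 / 125)\<^sup>2 * (M * (real b * p\<^sup>2)) \<le> (18 / 125)\<^sup>2 * (1157 / 24)"
      using M_bounds(2) by (rule mult_left_mono) simp
    also have "\<dots> \<le> (1::real)"
      by (simp add: power2_eq_square)
    also have "(18 / 125)\<^sup>2 * (M * (real b * p\<^sup>2)) = (18 / 125 * sqrt (real b) * p * sqrt M)\<^sup>2"
      using M_bounds(1) by (simp only: power_mult_distrib real_sqrt_pow2) (simp add: power_mult_distrib)
    finally have "(18 / 125 * sqrt (real b) * p * sqrt M)\<^sup>2 \<le> 1\<^sup>2"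
      by simp
    then have "18 / 125 * sqrt (real b) * p * sqrt M \<le> 1"
      by (rule power2_le_imp_le) simp
    then show ?thesis
      using L M_bounds(1) by (simp add: assms(17) field_simps)
  qed
  moreover have "1 / (real K + 1) * E K \<le> 526 * L\<^sup>2 * (norm (x0 - xstar))\<^sup>2 / (real b * p\<^sup>2 * (real K + 1))" for K
  proof -
    have "1 / (real K + 1) * E K \<le> 1 / (real K + 1) * (526 * D / (real b * p\<^sup>2))"
    proof (rule mult_left_mono)
      have "452 * D / (real b * p\<^sup>2) \<le> 526 * D / (real b * p\<^sup>2)"
        using D bp by (intro divide_right_mono) auto
      then show "E K \<le> 526 * D / (real b * p\<^sup>2)"
        using E[of K] by simp
    qed simp
    then show ?thesis
      by (simp add: D_def assms(19) mult_ac)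
  qed
  moreover have "\<exists>K. 1 / (real K + 1) * E K \<le> \<epsilon>\<^sup>2
          \<and> (\<integral>\<omega>. real (component_evals n b (\<lambda>k. coin k \<omega>) K) \<partial>P)
              \<le> real n + of_int \<lfloor>4 * 731 * L\<^sup>2 * R\<^sub>0\<^sup>2 * real n powr (2 / 3) / \<epsilon>\<^sup>2\<rfloor>"
    if "n \<ge> 2" and pn: "p = real n powr (- 1 / 3)" and bn: "int b = \<lfloor>real n powr (2 / 3)\<rfloor>" and "\<epsilon> > 0"
    for \<epsilon> :: real
  proof -
    define t where "t = real n powr (2 / 3)"
    have n: "0 < real n"
      using that by simp
    then have t: "0 < t"
      by (simp add: t_def)
    have "p\<^sup>2 = real n powr (- (2 / 3))"
      unfolding pn power2_eq_square by (simp flip: powr_add)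
    then have p2: "p\<^sup>2 = 1 / t"
      by (simp add: t_def powr_minus_divide)
    have np: "real n * p = t"
    proof -
      have "real n * p = real n powr 1 * real n powr (- 1 / 3)"
        using n by (simp add: pn)
      then show ?thesis
        by (simp only: powr_add[symmetric]) (simp add: t_def)
    qed
    have "1 \<le> real b"
      using batch_size by simp
    moreover have "t \<le> 2 * real b"
    proof -
      have "t < real b + 1"
        using bn unfolding t_def[symmetric] by linarith
      then show ?thesis
        using \<open>1 \<le> real b\<close> by linarith
    qed
    ultimately obtain K where K: "452 * (D / \<epsilon>\<^sup>2) * t / real b \<le> real K + 1"
        "real K * (t + 3 * real b) \<le> of_int \<lfloor>2924 * (D / \<epsilon>\<^sup>2) * t\<rfloor>"
      using iteration_budget[of "D / \<epsilon>\<^sup>2" t "real b"] D t by auto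
    have "E K \<le> 452 * D * t / real b"
      using E[of K] by (simp add: p2)
    also have "\<dots> \<le> \<epsilon>\<^sup>2 * (real K + 1)"
      using K(1) \<open>\<epsilon> > 0\<close> b by (simp add: field_simps)
    finally have "1 / (real K + 1) * E K \<le> \<epsilon>\<^sup>2"
      by (simp add: field_simps)
    moreover have "(\<integral>\<omega>. real (component_evals n b (\<lambda>k. coin k \<omega>) K) \<partial>P)
        \<le> real n + of_int \<lfloor>4 * 731 * L\<^sup>2 * R\<^sub>0\<^sup>2 * real n powr (2 / 3) / \<epsilon>\<^sup>2\<rfloor>"
      unfolding S.expectation_component_evals[OF S.batch_le] np t_def[symmetric]
      using K(2) by (simp add: D_def algebra_simps)
    ultimately show ?thesis
      by blast
  qed
  ultimately show ?thesis
    unfolding E_def by blast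
qed

end
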